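(* Let $m,N\ge 1$ be integers, let $\tau=e^{2\pi i/m}$, and let $\lambda,\mu,\rho\in\mathbb C$. Consider linear operators acting on (sufficiently regular, e.g. meromorphic) functions $\psi(q_1,\dots,q_N)$ of $(q_1,\dots,q_N)\in(\mathbb C^\times)^N$, where $q_i$ also denotes the operator of multiplication by $q_i$. For $1\le i\neq j\le N$ define \[ (\mathscr P_{ij}\psi)(\dots,q_i,\dots,q_j,\dots)=\psi(\dots,q_j,\dots,q_i,\dots),\qquad (\mathscr Q_i\psi)(\dots,q_i,\dots)=\psi(\dots,\tau q_i,\dots),\qquad (\mathscr K_i\psi)(\dots,q_i,\dots)=\psi(\dots,q_i^{-1},\dots), \] and, for $i=1,\dots,N$, the operators \begin{align*} D_i ={}& q_i\frac{\partial}{\partial q_i} +\lambda\sum_{j\neq i}\sum_{s=0}^{m-1}\left(\frac{q_i}{q_i-\tau^s q_j}\,\mathscr Q_i^{-s}\mathscr P_{ij}\mathscr Q_i^{s}+\frac{q_i}{q_i-\tau^{-s}q_j^{-1}}\,\mathscr K_i\mathscr Q_i^{-s}\mathscr P_{ij}\mathscr Q_i^{s}\mathscr K_i\right)\\ &+\sum_{s=0}^{m-1}\frac{\mu\tau^s q_i-\rho}{\tau^s q_i-\tau^{-s}q_i^{-1}}\,\mathscr Q_i^{2s}\mathscr K_i -\lambda\sum_{j>i}\sum_{s=0}^{m-1}\mathscr Q_i^{-s}\mathscr P_{ij}\mathscr Q_i^{s}. \end{align*} Then the following operator identities hold: \begin{enumerate} \item $\mathscr K_1 D_1=-D_1\mathscr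 K_1+\mu\sum_{s=0}^{m-1}\mathscr Q_1^{2s}$ and $\mathscr Q_1D_1=D_1\mathscr Q_1$; \item $\Big(D_1+\lambda\sum_{s=0}^{m-1}\mathscr Q_1^{-s}\mathscr P_{12}\mathscr Q_1^{s}\Big)\mathscr K_2=\mathscr K_2\Big(D_1+\lambda\sum_{s=0}^{m-1}\mathscr Q_1^{-s}\mathscr P_{12}\mathscr Q_1^{s}\Big)$ and $D_1\mathscr Q_2=\mathscr Q_2D_1$ (for $N\ge2$); \item $D_1\Big(\mathscr P_{12}D_1\mathscr P_{12}+\lambda\sum_{s=0}^{m-1}\mathscr Q_1^{s}\mathscr P_{12}\mathscr Q_1^{-s}\Big)=\Big(\mathscr P_{12}D_1\mathscr P_{12}+\lambda\sum_{s=0}^{m-1}\mathscr Q_1^{s}\mathscr P_{12}\mathscr Q_1^{-s}\Big)D_1$ (for $N\ge 2$), and $\mathscr P_{j,j+1}D_1=D_1\mathscr P_{j,j+1}$ for all $1<j\le N-1$; \item $D_{i+1}=\mathscr P_{i,i+1}D_i\mathscr P_{i,i+1}+\lambda\sum_{s=0}^{m-1}\mathscr Q_i^{s}\mathscr P_{i,i+1}\mathscr Q_i^{-s}$ for all $i=1,\dots,N-1$. \end{enumerate}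
   Context: These identities are the defining relations of an algebra $H_{\lambda,\mu}(W(m,N))$ attached to the wreath product $W(m,N)=\mathrm{Dih}_m\wr S_N$, with generators realized as $a=\mathscr Q_1$, $b=\mathscr K_1$, $e_i=\mathscr P_{i,i+1}$, $D=D_1$. Products of operators denote composition; rational functions of the $q_i$ act by multiplication. *)

theory Defs
  imports "HOL-Analysis.Analysis"
begin

text \<open>Points of (C^x)^N are represented as functions q :: nat => complex, of which only
  the coordinates 1..N are used.  A "function" psi is a complex valued function of such points;
  an operator maps functions to functions.  Composition of operators is function composition.\<close>

type_synonym cfun = "(nat \<Rightarrow> complex) \<Rightarrow> complex"
type_synonym cop = "cfun \<Rightarrow> cfun"

definition tau :: "nat \<Rightarrow> complex" where
  "tau m = exp (2 * pi * \<i> / of_nat m)"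

definition Pop :: "nat \<Rightarrow> nat \<Rightarrow> cop" where
  "Pop i j psi = (\<lambda>q. psi (q(i := q j, j := q i)))"

definition Qpow :: "nat \<Rightarrow> nat \<Rightarrow> int \<Rightarrow> cop" where
  "Qpow m i k psi = (\<lambda>q. psi (q(i := tau m powi k * q i)))"

definition Kop :: "nat \<Rightarrow> cop" where
  "Kop i psi = (\<lambda>q. psi (q(i := inverse (q i))))"

definition Euler :: "nat \<Rightarrow> cop" where
  "Euler i psi = (\<lambda>q. q i * deriv (\<lambda>z. psi (q(i := z))) (q i))"

definition Dop :: "nat \<Rightarrow> nat \<Rightarrow> complex \<Rightarrow> complex \<Rightarrow> complex \<Rightarrow> nat \<Rightarrow> cop" where
  "Dop m N lam mu rho i psi = (\<lambda>q.
     Euler i psi q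
   + lam * (\<Sum>j\<in>{1..N} - {i}. \<Sum>s<m.
        q i / (q i - tau m ^ s * q j)
          * Qpow m i (- int s) (Pop i j (Qpow m i (int s) psi)) q
      + q i / (q i - tau m powi (- int s) * inverse (q j))
          * Kop i (Qpow m i (- int s) (Pop i j (Qpow m i (int s) (Kop i psi)))) q)
   + (\<Sum>s<m. (mu * tau m ^ s * q i - rho) / (tau m ^ s * q i - tau m powi (- int s) * inverse (q i))
          * Qpow m i (2 * int s) (Kop i psi) q)
   - lam * (\<Sum>j\<in>{i<..N}. \<Sum>s<m. Qpow m i (- int s) (Pop i j (Qpow m i (int s) psi)) q))"

text \<open>The complement of the singular hyperplanes of the operators D_i.\<close>
definition Reg :: "nat \<Rightarrow> nat \<Rightarrow> (nat \<Rightarrow> complex) set" where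
  "Reg m N = {q. \<forall>i\<in>{1..N}. q i \<noteq> 0
      \<and> (\<forall>s<m. tau m ^ s * q i \<noteq> tau m powi (- int s) * inverse (q i))
      \<and> (\<forall>j\<in>{1..N}. j \<noteq> i \<longrightarrow>
            (\<forall>s<m. q i \<noteq> tau m ^ s * q j \<and> q i \<noteq> tau m powi (- int s) * inverse (q j)))}"

definition invariant_dom :: "nat \<Rightarrow> nat \<Rightarrow> (nat \<Rightarrow> complex) set \<Rightarrow> bool" where
  "invariant_dom m N U \<longleftrightarrow> (\<forall>q\<in>U. \<forall>i\<in>{1..N}.
      q(i := tau m * q i) \<in> U \<and> q(i := inverse (q i)) \<in> U
    \<and> (\<forall>j\<in>{1..N}. q(i := q j, j := q i) \<in> U))"

text \<open>Holomorphic in the variables q_1..q_N on U (Osgood: continuous and separately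
  holomorphic); the remaining coordinates are inert continuous parameters.\<close>
definition holo_on :: "nat \<Rightarrow> (nat \<Rightarrow> complex) set \<Rightarrow> cfun \<Rightarrow> bool" where
  "holo_on N U psi \<longleftrightarrow> continuous_on U psi \<and>
     (\<forall>q\<in>U. \<forall>i\<in>{1..N}. (\<lambda>z. psi (q(i := z))) field_differentiable (at (q i)))"

end

theory Submission
  imports Defs "HOL-Complex_Analysis.Complex_Analysis"
begin

text \<open>Each \<open>D\<^sub>i\<close> is an Euler derivative plus a sum of weighted substitutions, indexed by the dihedral
  group acting on one coordinate. All identities but the commutation of \<open>D\<^sub>1\<close> with
  \<open>P\<^sub>1\<^sub>2 D\<^sub>1 P\<^sub>1\<^sub>2 + \<dots>\<close> follow by reindexing these sums and comparing
  weights. By the last identity the latter operator is \<open>D\<^sub>2\<close>,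
  so the claim is \<open>[D\<^sub>1, D\<^sub>2] = 0\<close>. The commutator splits into the mixed partial derivatives (equal by
  holomorphy), the first-order terms, and products of two substitutions. The last kind splits further
  into contributions of one pair (antisymmetric under exchange of the two group elements), of a pair and
  a one-body term, and of three coordinates (a classical Yang-Baxter relation for each of the two
  3-cycles); each vanishes group element by group element because of an identity between rational
  functions.\<close>

section \<open>Mixed partial derivatives\<close>

text \<open>The order \<open>m\<close> enters through the group \<open>roots m\<close>: with group
  elements in place of exponents of \<open>tau m\<close>, reindexing becomes translation in a group
  instead of arithmetic modulo \<open>m\<close>. The asymmetric last sum of \<open>Dop\<close>
  shapes everything else. It subtracts 1 from the weight of each rotation towards a later
  coordinate; the shifted weights merely change sign when the first coordinate is inverted, and the
  weight of a reflection in the second operator is, up to sign, its weight in the first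
  (\<open>beta_eq_alpha\<close>). All cancellations between pairs rest on that sign rule. The
  analytic obstacle is that \<open>deriv\<close> is total: splitting the derivative of a sum
  requires differentiability of every summand, among them the first derivatives of
  \<open>psi\<close>, while only continuity and separate holomorphy are given. In the commutator the
  derivative in one coordinate meets the one-body sum of the other coordinate, so
  \<open>kappa\<close> itself is never differentiated.\<close>

lemma difference_quotient_bound:
  fixes F :: "complex \<Rightarrow> complex"
  assumes "0 < r" and hol: "F holomorphic_on cball w r"
    and B: "\<And>x. x \<in> cball w r \<Longrightarrow> norm (F x) \<le> B"
    and h: "h \<noteq> 0" "norm h \<le> r / 2"
  shows "norm ((F (w + h) - F w) / h - deriv F w) \<le> 8 * B / r\<^sup>2 * norm h"
proof -
  have holb: "F holomorphic_on ball w r"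
    using hol ball_subset_cball holomorphic_on_subset by blast
  \<comment> \<open>The Cauchy estimate on the circle of radius \<open>r/2\<close> about a point of
    the half disc gives \<open>2! * B / (r/2)^2\<close>, whence the constant 8.\<close>
  have d2: "norm ((deriv ^^ Suc 1) F x) \<le> 8 * B / r\<^sup>2" if x: "x \<in> cball w (r/2)" for x
  proof -
    have sub: "cball x (r/2) \<subseteq> cball w r"
      using x by (simp add: cball_subset_cball_iff dist_commute)
    have "norm ((deriv ^^ 2) F x) \<le> fact 2 * B / (r/2) ^ 2"
    proof (rule Cauchy_inequality)
      show "F holomorphic_on ball x (r/2)"
        using hol sub ball_subset_cball holomorphic_on_subset by blast
      show "continuous_on (cball x (r/2)) F"
        using hol sub holomorphic_on_imp_continuous_on continuous_on_subset by blast
      show "norm (F y) \<le> B" if "norm (x - y) = r / 2" for y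
        using that sub by (intro B) (auto simp: dist_norm)
    qed (use \<open>0 < r\<close> in auto)
    then show ?thesis by (simp add: numeral_2_eq_2 field_simps)
  qed
  have "norm ((deriv ^^ 0) F (w + h) - (\<Sum>i\<le>1. (deriv ^^ i) F w * (w + h - w) ^ i / fact i))
      \<le> 8 * B / r\<^sup>2 * norm (w + h - w) ^ Suc 1 / fact 1"
  proof (rule complex_Taylor[where S = "cball w (r/2)"])
    show "((deriv ^^ i) F has_field_derivative (deriv ^^ Suc i) F x) (at x within cball w (r/2))"
      if "x \<in> cball w (r/2)" "i \<le> 1" for i x
    proof -
      have "x \<in> ball w r" using that \<open>0 < r\<close> by auto
      then have "(deriv ^^ i) F field_differentiable at x"
        using holomorphic_higher_deriv[OF holb open_ball, of i]
        by (simp add: holomorphic_on_imp_differentiable_at)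
      then show ?thesis
        by (simp add: field_differentiable_derivI has_field_derivative_at_within)
    qed
    show "norm ((deriv ^^ Suc 1) F x) \<le> 8 * B / r\<^sup>2" if "x \<in> cball w (r/2)" for x
      by (rule d2[OF that])
  qed (use h \<open>0 < r\<close> in \<open>auto simp: dist_norm\<close>)
  then have *: "norm (F (w + h) - F w - deriv F w * h) \<le> 8 * B / r\<^sup>2 * norm h ^ 2"
    by (simp add: numeral_2_eq_2 algebra_simps)
  have "norm ((F (w + h) - F w) / h - deriv F w) = norm (F (w + h) - F w - deriv F w * h) / norm h"
    using h(1) by (simp add: field_simps flip: norm_divide)
  also have "\<dots> \<le> 8 * B / r\<^sup>2 * norm h ^ 2 / norm h"
    using * by (intro divide_right_mono) auto
  finally show ?thesis
    using h(1) by (simp add: power2_eq_square)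
qed

text \<open>The difference quotients in \<open>w\<close> are holomorphic in \<open>z\<close> and
  converge uniformly, by a Cauchy bound independent of \<open>z\<close>. Derivatives pass to such a
  limit, so the limit of their \<open>z\<close>-derivatives is both the \<open>z\<close>-derivative
  of the \<open>w\<close>-derivative and the limit of a difference quotient of the
  \<open>z\<close>-derivative. Existence and equality come together.\<close>

lemma mixed_partial_derivatives:
  fixes f :: "complex \<Rightarrow> complex \<Rightarrow> complex"
  assumes "open V" "(z0, w0) \<in> V" and cont: "continuous_on V (\<lambda>(z, w). f z w)"
    and dz: "\<And>z w. (z, w) \<in> V \<Longrightarrow> (\<lambda>z. f z w) field_differentiable at z"
    and dw: "\<And>z w. (z, w) \<in> V \<Longrightarrow> f z field_differentiable at w"
  obtains d where "((\<lambda>z. deriv (f z) w0) has_field_derivative d) (at z0)"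
    and "((\<lambda>w. deriv (\<lambda>z. f z w) z0) has_field_derivative d) (at w0)"
proof -
  obtain A1 A2 where A: "open A1" "open A2" "z0 \<in> A1" "w0 \<in> A2" "A1 \<times> A2 \<subseteq> V"
    using open_prod_elim[OF assms(1,2)] by (metis mem_Sigma_iff)
  obtain r1 r2 where r12: "r1 > 0" "cball z0 r1 \<subseteq> A1" "r2 > 0" "cball w0 r2 \<subseteq> A2"
    using A by (meson open_contains_cball)
  define r where "r = min r1 r2"
  have r: "r > 0" and sub: "cball z0 r \<times> cball w0 r \<subseteq> V"
    using r12 A by (fastforce simp: r_def)+
  have "compact ((\<lambda>(z, w). f z w) ` (cball z0 r \<times> cball w0 r))"
    by (intro compact_continuous_image continuous_on_subset[OF cont sub] compact_Times compact_cball)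
  then obtain B where "\<forall>y \<in> (\<lambda>(z, w). f z w) ` (cball z0 r \<times> cball w0 r). norm y \<le> B"
    using compact_imp_bounded bounded_iff by meson
  then have B: "norm (f z w) \<le> B" if "z \<in> cball z0 r" "w \<in> cball w0 r" for z w
    using that by force
  define C where "C = 8 * B / r\<^sup>2"
  have inV: "(z, w) \<in> V" if "z \<in> cball z0 r" "w \<in> cball w0 r" for z w
    using sub that by auto
  have bound: "norm ((f z (w0 + h) - f z w0) / h - deriv (f z) w0) \<le> C * norm h"
    if "z \<in> cball z0 r" "h \<noteq> 0" "norm h \<le> r / 2" for z h
    unfolding C_def
  proof (rule difference_quotient_bound)
    show "f z holomorphic_on cball w0 r"
      unfolding holomorphic_on_def
      using dw inV that(1) field_differentiable_at_within by blast
  qed (use r B that in auto)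
  define g where "g = (\<lambda>h z. (f z (w0 + h) - f z w0) / h)"
  define g' where "g' = (\<lambda>h z. (deriv (\<lambda>z. f z (w0 + h)) z - deriv (\<lambda>z. f z w0) z) / h)"
  have dg: "(g h has_field_derivative g' h z) (at z)"
    if "z \<in> cball z0 r" "norm h \<le> r" for z h
  proof -
    have "(z, w0 + h) \<in> V" "(z, w0) \<in> V"
      using that r by (auto intro!: inV simp: dist_norm)
    then show ?thesis
      unfolding g_def g'_def
      by (intro DERIV_cdivide DERIV_diff dz[THEN field_differentiable_derivI])
  qed
  have ev: "\<forall>\<^sub>F h::complex in at 0. h \<noteq> 0 \<and> norm h < e" if "e > 0" for e
    using eventually_at_ball'[OF that, of 0 UNIV] by eventually_elim (auto simp: dist_norm)
  have cg: "\<forall>\<^sub>F h in at 0. continuous_on (cball z0 r) (g h) \<and>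
        (\<forall>w\<in>ball z0 r. (g h has_field_derivative g' h w) (at w))"
    using ev[OF r]
  proof (eventually_elim, intro conjI ballI)
    case (elim h)
    show "continuous_on (cball z0 r) (g h)"
      using elim by (intro DERIV_continuous_on[of _ _ "g' h"] dg[THEN has_field_derivative_at_within]) auto
    show "(g h has_field_derivative g' h w) (at w)" if "w \<in> ball z0 r" for w
      using elim that by (intro dg) auto
  qed
  have ul: "uniform_limit (cball z0 r) g (\<lambda>z. deriv (f z) w0) (at 0)"
    unfolding uniform_limit_iff
  proof (intro allI impI)
    fix e :: real assume "e > 0"
    \<comment> \<open>\<open>C\<close> may be 0, so 1 is added before dividing by it.\<close>
    have C: "\<bar>C\<bar> + 1 > 0" by simp
    then have "min (r/2) (e / (\<bar>C\<bar> + 1)) > 0"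
      using r \<open>e > 0\<close> by simp
    from ev[OF this] show "\<forall>\<^sub>F h in at 0. \<forall>z\<in>cball z0 r. dist (g h z) (deriv (f z) w0) < e"
    proof (eventually_elim, intro ballI)
      case (elim h)
      fix z assume z: "z \<in> cball z0 r"
      have "dist (g h z) (deriv (f z) w0) \<le> C * norm h"
        using bound[OF z, of h] elim by (simp add: g_def dist_norm)
      also have "\<dots> \<le> (\<bar>C\<bar> + 1) * norm h"
        by (intro mult_right_mono) auto
      also have "\<dots> < e"
        using elim C by (simp add: pos_less_divide_eq mult.commute)
      finally show "dist (g h z) (deriv (f z) w0) < e" .
    qed
  qed
  obtain d where "\<And>w. w \<in> ball z0 r \<Longrightarrow> ((\<lambda>z. deriv (f z) w0) has_field_derivative d w) (at w)
      \<and> ((\<lambda>h. g' h w) \<longlongrightarrow> d w) (at 0)"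
    using has_complex_derivative_uniform_limit[OF cg ul _ r] by (metis at_neq_bot)
  from this[of z0] have d: "((\<lambda>z. deriv (f z) w0) has_field_derivative d z0) (at z0)"
      "((\<lambda>h. g' h z0) \<longlongrightarrow> d z0) (at 0)"
    using r by simp_all
  show ?thesis
  proof (rule that[OF d(1)])
    show "((\<lambda>w. deriv (\<lambda>z. f z w) z0) has_field_derivative d z0) (at w0)"
      using d(2) by (simp add: DERIV_def g'_def)
  qed
qed

section \<open>Dihedral reflections and the normal form of the operators\<close>

definition roots :: "nat \<Rightarrow> complex set" where
  "roots m = {g. g ^ m = 1}"

text \<open>The pair \<open>(g, e)\<close> stands for the map \<open>x \<mapsto> g x\<^sup>\<plusminus>\<^sup>1\<close> of the dihedral group acting on one
  coordinate, with exponent 1 iff \<open>e\<close> holds.\<close>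

type_synonym dih = "complex \<times> bool"

definition dihs :: "nat \<Rightarrow> dih set" where
  "dihs m = roots m \<times> UNIV"

definition act :: "dih \<Rightarrow> complex \<Rightarrow> complex" where
  "act c x = fst c * (if snd c then x else inverse x)"

definition dmul :: "dih \<Rightarrow> dih \<Rightarrow> dih" where
  "dmul c d = (fst c * (if snd c then fst d else inverse (fst d)), snd c = snd d)"

definition dinv :: "dih \<Rightarrow> dih" where
  "dinv c = (if snd c then inverse (fst c) else fst c, snd c)"

text \<open>The exponent of the substitution, which is also its logarithmic derivative; hence the
  sign it produces on \<open>Euler\<close>.\<close>

definition dsgn :: "dih \<Rightarrow> complex" where
  "dsgn c = (if snd c then 1 else - 1)"

text \<open>\<open>Q\<^sub>i\<^sup>2\<^sup>s K\<^sub>i\<close> is composition with \<open>rot (\<tau>\<^sup>s)\<close> in coordinate \<open>i\<close>.\<close>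

definition rot :: "complex \<Rightarrow> dih" where
  "rot g = (inverse (g\<^sup>2), False)"

definition move :: "nat \<Rightarrow> dih \<Rightarrow> (nat \<Rightarrow> complex) \<Rightarrow> nat \<Rightarrow> complex" where
  "move i c q = q(i := act c (q i))"

text \<open>A reflection of the wreath product. The inverse in the second coordinate makes it an
  involution for distinct \<open>i\<close>, \<open>j\<close> and nonzero \<open>fst c\<close>; its
  fixed points \<open>q i = act c (q j)\<close> form the polar set of
  \<open>alpha0 c (q i) (q j)\<close>.\<close>

definition reflect :: "nat \<Rightarrow> nat \<Rightarrow> dih \<Rightarrow> (nat \<Rightarrow> complex) \<Rightarrow> nat \<Rightarrow> complex" where
  "reflect i j c q = q(i := act c (q j), j := act (dinv c) (q i))"

definition pair_op :: "nat \<Rightarrow> (dih \<Rightarrow> complex \<Rightarrow> complex \<Rightarrow> complex) \<Rightarrow> nat \<Rightarrow> nat \<Rightarrow> cop" where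
  "pair_op m a i j phi q = (\<Sum>c\<in>dihs m. a c (q i) (q j) * phi (reflect i j c q))"

text \<open>The sum runs over roots, not over reflections: for even \<open>m\<close> the roots
  \<open>g\<close> and \<open>- g\<close> give the same \<open>rot\<close>, but in general different
  weights \<open>kappa\<close>.\<close>

definition one_op :: "nat \<Rightarrow> (complex \<Rightarrow> complex \<Rightarrow> complex) \<Rightarrow> nat \<Rightarrow> cop" where
  "one_op m b i phi q = (\<Sum>g\<in>roots m. b g (q i) * phi (move i (rot g) q))"

definition alpha0 :: "dih \<Rightarrow> complex \<Rightarrow> complex \<Rightarrow> complex" where
  "alpha0 c x y = x / (x - act c y)"

text \<open>The subtracted 1 is the last sum of \<open>Dop\<close>, which contains only rotations
  and only partners of larger index; for partners of smaller index the weight stays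
  \<open>alpha0\<close>.\<close>

definition alpha :: "dih \<Rightarrow> complex \<Rightarrow> complex \<Rightarrow> complex" where
  "alpha c x y = alpha0 c x y - (if snd c then 1 else 0)"

text \<open>\<open>beta\<close> is the coefficient of \<open>reflect 1 2 c\<close> in \<open>D\<^sub>2\<close>; there the pair sum comes with the
  reflections \<open>reflect 2 1 (dinv c)\<close>.\<close>

definition beta :: "dih \<Rightarrow> complex \<Rightarrow> complex \<Rightarrow> complex" where
  "beta c x y = alpha0 (dinv c) y x"

definition kappa :: "complex \<Rightarrow> complex \<Rightarrow> complex \<Rightarrow> complex \<Rightarrow> complex" where
  "kappa mu rho g x = (mu * g * x - rho) / (g * x - inverse (g * x))"

section \<open>Dihedral group laws and reindexing of sums over the group\<close>

lemma roots_nz: "m \<ge> 1 \<Longrightarrow> g \<in> roots m \<Longrightarrow> g \<noteq> 0"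
  by (auto simp: roots_def zero_power)

lemma roots_mult [intro]: "g \<in> roots m \<Longrightarrow> h \<in> roots m \<Longrightarrow> g * h \<in> roots m"
  by (auto simp: roots_def power_mult_distrib)

lemma roots_inverse [intro]: "g \<in> roots m \<Longrightarrow> inverse g \<in> roots m"
  by (auto simp: roots_def power_inverse)

lemma roots_1 [simp]: "1 \<in> roots m"
  by (simp add: roots_def)

lemma roots_power [intro]: "g \<in> roots m \<Longrightarrow> g ^ k \<in> roots m"
  by (induction k) auto

lemma tau_power_root: "m \<ge> 1 \<Longrightarrow> tau m ^ s \<in> roots m"
proof -
  assume "m \<ge> 1"
  then have "tau m ^ m = 1"
    by (simp add: tau_def flip: exp_of_nat_mult)
  then show ?thesis by (intro roots_power) (simp add: roots_def)
qed

lemma bij_betw_tau_power: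
  assumes "m \<ge> 1"
  shows "bij_betw (\<lambda>s. tau m ^ s) {..<m} (roots m)"
proof -
  have eq: "(\<lambda>s. cis (2 * pi * real s / real m)) = (\<lambda>s. tau m ^ s)"
    unfolding tau_def cis_conv_exp by (rule ext) (simp add: field_simps flip: exp_of_nat_mult)
  have "0 < m" using assms by simp
  from Complex.bij_betw_roots_unity[OF this] show ?thesis
    unfolding eq roots_def .
qed

lemma sum_tau_power:
  assumes "m \<ge> 1"
  shows "(\<Sum>s<m. H (tau m ^ s)) = (\<Sum>g\<in>roots m. H g)"
  by (rule sum.reindex_bij_betw[OF bij_betw_tau_power[OF assms]])

lemma sum_roots_inverse: "(\<Sum>g\<in>roots m. H (inverse g)) = (\<Sum>g\<in>roots m. H g)"
  by (rule sum.reindex_bij_witness[where i = inverse and j = inverse]) auto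

lemma sum_roots_mult:
  assumes "m \<ge> 1" "h \<in> roots m"
  shows "(\<Sum>g\<in>roots m. H (h * g)) = (\<Sum>g\<in>roots m. H g)"
  using roots_nz[OF assms] assms(2)
  by (intro sum.reindex_bij_witness[where i = "\<lambda>g. inverse h * g" and j = "\<lambda>g. h * g"])
    (auto simp flip: mult.assoc)

lemma sum_dihs:
  assumes "m \<ge> 1"
  shows "(\<Sum>c\<in>dihs m. H c) = (\<Sum>g\<in>roots m. H (g, True)) + (\<Sum>g\<in>roots m. H (g, False))"
proof -
  have "(\<Sum>c\<in>dihs m. H c) = (\<Sum>g\<in>roots m. \<Sum>e\<in>UNIV. H (g, e))"
    unfolding dihs_def by (simp add: sum.cartesian_product)
  then show ?thesis by (simp add: UNIV_bool sum.distrib add.commute)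
qed

lemma act_dmul [simp]: "act (dmul c d) x = act c (act d x)"
  by (simp add: act_def dmul_def)

lemma act_dinv [simp]:
  "fst c \<noteq> 0 \<Longrightarrow> act (dinv c) (act c x) = x" "fst c \<noteq> 0 \<Longrightarrow> act c (act (dinv c) x) = x"
  by (simp_all add: act_def dinv_def)

lemma act_eq_0_iff [simp]: "fst c \<noteq> 0 \<Longrightarrow> act c x = 0 \<longleftrightarrow> x = 0"
  by (simp add: act_def)

lemma fst_dih_nz [simp]:
  "fst c \<noteq> 0 \<Longrightarrow> fst d \<noteq> 0 \<Longrightarrow> fst (dmul c d) \<noteq> 0" "fst c \<noteq> 0 \<Longrightarrow> fst (dinv c) \<noteq> 0"
  "g \<noteq> 0 \<Longrightarrow> fst (rot g) \<noteq> 0"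
  by (simp_all add: dmul_def dinv_def rot_def)

lemma dinv_dinv [simp]: "dinv (dinv c) = c"
  by (cases c) (simp add: dinv_def)

lemma dinv_dmul [simp]: "dinv (dmul c d) = dmul (dinv d) (dinv c)"
  by (simp add: dmul_def dinv_def)

lemma dmul_dinv [simp]:
  "fst c \<noteq> 0 \<Longrightarrow> dmul c (dmul (dinv c) d) = d" "fst c \<noteq> 0 \<Longrightarrow> dmul (dinv c) (dmul c d) = d"
  by (cases d; simp add: dmul_def dinv_def)+

lemma dmul_dinv_right [simp]:
  "fst c \<noteq> 0 \<Longrightarrow> dmul (dmul d c) (dinv c) = d" "fst c \<noteq> 0 \<Longrightarrow> dmul (dmul d (dinv c)) c = d"
  by (cases d; simp add: dmul_def dinv_def)+

lemma snd_dih [simp]: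
  "snd (dmul c d) \<longleftrightarrow> snd c = snd d" "snd (dinv c) = snd c" "\<not> snd (rot g)"
  by (simp_all add: dmul_def dinv_def rot_def)

lemma dinv_rot [simp]: "dinv (rot g) = rot g"
  by (simp add: dinv_def rot_def)

lemma dihs_closed [intro]:
  "c \<in> dihs m \<Longrightarrow> d \<in> dihs m \<Longrightarrow> dmul c d \<in> dihs m" "c \<in> dihs m \<Longrightarrow> dinv c \<in> dihs m"
  "g \<in> roots m \<Longrightarrow> rot g \<in> dihs m"
  by (auto simp: dihs_def dmul_def dinv_def rot_def intro!: roots_mult roots_inverse roots_power)

lemma dihs_nz: "m \<ge> 1 \<Longrightarrow> c \<in> dihs m \<Longrightarrow> fst c \<noteq> 0"
  using roots_nz by (auto simp: dihs_def)

lemma sum_dihs_dinv: "(\<Sum>c\<in>dihs m. H (dinv c)) = (\<Sum>c\<in>dihs m. H c)"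
  by (rule sum.reindex_bij_witness[where i = dinv and j = dinv]) auto

lemma sum_dihs_dmul:
  assumes "m \<ge> 1" "d \<in> dihs m"
  shows "(\<Sum>c\<in>dihs m. H (dmul d c)) = (\<Sum>c\<in>dihs m. H c)"
    and "(\<Sum>c\<in>dihs m. H (dmul c d)) = (\<Sum>c\<in>dihs m. H c)"
proof -
  note d = dihs_nz[OF assms] assms(2)
  show "(\<Sum>c\<in>dihs m. H (dmul d c)) = (\<Sum>c\<in>dihs m. H c)"
    using d by (intro sum.reindex_bij_witness[where i = "dmul (dinv d)" and j = "dmul d"]) auto
  show "(\<Sum>c\<in>dihs m. H (dmul c d)) = (\<Sum>c\<in>dihs m. H c)"
    using d by (intro sum.reindex_bij_witness[where i = "\<lambda>c. dmul c (dinv d)" and j = "\<lambda>c. dmul c d"]) auto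
qed

lemma dinv_root [simp]: "dinv (g, True) = (inverse g, True)" "dinv (g, False) = (g, False)"
  by (simp_all add: dinv_def)

lemma rot_conv: "act (rot g) x = inverse (g\<^sup>2) * inverse x"
  by (simp add: act_def rot_def)

section \<open>Translation of the operators into dihedral substitutions\<close>

lemma Qpow_Pop_Qpow:
  assumes "i \<noteq> j"
  shows "Qpow m i (- int s) (Pop i j (Qpow m i (int s) phi)) q = phi (reflect i j (tau m ^ s, True) q)"
    "Qpow m i (int s) (Pop i j (Qpow m i (- int s) phi)) q
      = phi (reflect i j (inverse (tau m ^ s), True) q)"
  using assms
  by (simp_all add: Qpow_def Pop_def reflect_def act_def power_int_minus fun_upd_twist)

lemma Kop_Qpow_Pop_Qpow_Kop:
  assumes "i \<noteq> j"
  shows "Kop i (Qpow m i (- int s) (Pop i j (Qpow m i (int s) (Kop i phi)))) q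
    = phi (reflect i j (inverse (tau m ^ s), False) q)"
  using assms
  by (simp add: Kop_def Qpow_def Pop_def reflect_def act_def power_int_minus fun_upd_twist)

lemma Qpow_Kop: "Qpow m i (2 * int s) (Kop i phi) q = phi (move i (rot (tau m ^ s)) q)"
proof -
  have "tau m powi (2 * int s) = (tau m ^ s)\<^sup>2"
    by (simp add: power_int_def nat_mult_distrib mult.commute flip: power_mult)
  then show ?thesis by (simp add: Kop_def Qpow_def move_def rot_conv)
qed

lemma Dop_normal_form:
  assumes "m \<ge> 1"
  shows "Dop m N lam mu rho i phi q = Euler i phi q
    + lam * (\<Sum>j\<in>{1..N} - {i}. pair_op m (if i < j then alpha else alpha0) i j phi q)
    + one_op m (kappa mu rho) i phi q"
proof -
  define A where "A = {1..N} - {i}"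
  define F where "F = (\<lambda>j c. phi (reflect i j c q))"
  have 1: "(\<Sum>s<m. q i / (q i - tau m ^ s * q j)
          * Qpow m i (- int s) (Pop i j (Qpow m i (int s) phi)) q
      + q i / (q i - tau m powi (- int s) * inverse (q j))
          * Kop i (Qpow m i (- int s) (Pop i j (Qpow m i (int s) (Kop i phi)))) q)
    = (\<Sum>c\<in>dihs m. alpha0 c (q i) (q j) * F j c)" if "j \<in> A" for j
  proof -
    have "i \<noteq> j" using that by (auto simp: A_def)
    note [simp] = Qpow_Pop_Qpow[OF this] Kop_Qpow_Pop_Qpow_Kop[OF this]
    have "(\<Sum>s<m. q i / (q i - tau m ^ s * q j)
          * Qpow m i (- int s) (Pop i j (Qpow m i (int s) phi)) q
      + q i / (q i - tau m powi (- int s) * inverse (q j))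
          * Kop i (Qpow m i (- int s) (Pop i j (Qpow m i (int s) (Kop i phi)))) q)
      = (\<Sum>g\<in>roots m. alpha0 (g, True) (q i) (q j) * F j (g, True)
          + alpha0 (inverse g, False) (q i) (q j) * F j (inverse g, False))"
      unfolding F_def
      by (subst sum_tau_power[OF assms, symmetric]) (simp add: alpha0_def act_def power_int_minus)
    \<comment> \<open>The terms conjugated by \<open>Kop\<close> carry the root
      \<open>inverse g\<close>. Inversion permutes the roots, so these terms fill the other half of
      \<open>dihs m\<close>.\<close>
    also have "\<dots> = (\<Sum>c\<in>dihs m. alpha0 c (q i) (q j) * F j c)"
      by (simp add: sum.distrib sum_dihs[OF assms]
          sum_roots_inverse[of "\<lambda>g. alpha0 (g, False) (q i) (q j) * F j (g, False)"])
    finally show ?thesis .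
  qed
  have 2: "(\<Sum>s<m. Qpow m i (- int s) (Pop i j (Qpow m i (int s) phi)) q)
      = (\<Sum>c\<in>dihs m. (if snd c then 1 else 0) * F j c)" if "j \<in> {i<..N}" for j
    using that
    by (simp add: Qpow_Pop_Qpow F_def sum_dihs[OF assms]
        sum_tau_power[OF assms, where H = "\<lambda>g. phi (reflect i j (g, True) q)"])
  have pair: "pair_op m (if i < j then alpha else alpha0) i j phi q
      = (\<Sum>c\<in>dihs m. alpha0 c (q i) (q j) * F j c)
        - (if i < j then (\<Sum>c\<in>dihs m. (if snd c then 1 else 0) * F j c) else 0)" for j
    by (simp add: pair_op_def alpha_def F_def left_diff_distrib sum_subtractf)
  have 3: "(\<Sum>j\<in>A. if i < j then G j else 0) = (\<Sum>j\<in>{i<..N}. G j)" for G :: "nat \<Rightarrow> complex"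
    by (intro sum.mono_neutral_cong_right) (auto simp: A_def)
  have 4: "(\<Sum>s<m. (mu * tau m ^ s * q i - rho) / (tau m ^ s * q i - tau m powi (- int s) * inverse (q i))
          * Qpow m i (2 * int s) (Kop i phi) q) = one_op m (kappa mu rho) i phi q"
    unfolding one_op_def Qpow_Kop kappa_def
    by (subst sum_tau_power[OF assms, symmetric]) (simp add: power_int_minus)
  have 5: "(\<Sum>j\<in>A. \<Sum>s<m. q i / (q i - tau m ^ s * q j)
          * Qpow m i (- int s) (Pop i j (Qpow m i (int s) phi)) q
      + q i / (q i - tau m powi (- int s) * inverse (q j))
          * Kop i (Qpow m i (- int s) (Pop i j (Qpow m i (int s) (Kop i phi)))) q)
    = (\<Sum>j\<in>A. \<Sum>c\<in>dihs m. alpha0 c (q i) (q j) * F j c)"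
    by (rule sum.cong[OF refl 1])
  have 6: "(\<Sum>j\<in>{i<..N}. \<Sum>s<m. Qpow m i (- int s) (Pop i j (Qpow m i (int s) phi)) q)
      = (\<Sum>j\<in>{i<..N}. \<Sum>c\<in>dihs m. (if snd c then 1 else 0) * F j c)"
    by (rule sum.cong[OF refl 2])
  show ?thesis
    unfolding Dop_def A_def[symmetric] pair 4 5 6
    by (simp add: 3 sum_subtractf right_diff_distrib)
qed

section \<open>The relations involving one operator\<close>

text \<open>The function \<open>x / (x - y)\<close> is homogeneous of degree 0, and inverting both
  arguments gives \<open>y / (y - x)\<close>, its complement to 1.\<close>

lemma alpha0_act:
  assumes "fst c \<noteq> 0" "x \<noteq> 0" "y \<noteq> 0" "x \<noteq> y"
  shows "act c x / (act c x - act c y) = (if snd c then x / (x - y) else 1 - x / (x - y))"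
  using assms by (auto simp: act_def divide_simps) (auto simp: algebra_simps)

lemma kappa_mult: "kappa mu rho g (h * x) = kappa mu rho (g * h) x"
  by (simp add: kappa_def mult_ac)

text \<open>With \<open>z = g * x\<close> the two fractions have opposite denominators, so
  \<open>rho\<close> cancels in their sum and \<open>mu * (z - inverse z)\<close> remains above the
  denominator \<open>z - inverse z\<close>. This is the source of the \<open>mu\<close> term in the
  relation with \<open>Kop 1\<close>.\<close>

lemma kappa_inverse:
  assumes "g \<noteq> 0" "x \<noteq> 0" "g * x \<noteq> inverse (g * x)"
  shows "kappa mu rho (inverse g) (inverse x) = mu - kappa mu rho g x"
proof -
  define z where "z = g * x"
  have z: "z \<noteq> 0" "z - inverse z \<noteq> 0" using assms by (auto simp: z_def)
  have "kappa mu rho (inverse g) (inverse x) = (mu * inverse z - rho) / - (z - inverse z)"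
    by (simp add: kappa_def z_def mult_ac)
  moreover have "kappa mu rho g x = (mu * z - rho) / (z - inverse z)"
    by (simp add: kappa_def z_def mult_ac)
  moreover have "mu = (mu * z - mu * inverse z) / (z - inverse z)"
    using z(2) by (metis nonzero_mult_div_cancel_right right_diff_distrib)
  ultimately show ?thesis
    by (metis add_diff_cancel_left diff_add_cancel diff_diff_eq2 diff_divide_distrib minus_diff_eq minus_divide_left minus_divide_right)
qed

lemma alpha0_dmul:
  assumes "fst k \<noteq> 0" "fst c \<noteq> 0" "x \<noteq> 0" "y \<noteq> 0" "x \<noteq> act c y"
  shows "alpha0 (dmul k c) (act k x) y = (if snd k then alpha0 c x y else 1 - alpha0 c x y)"
  using alpha0_act[of k x "act c y"] assms by (simp add: alpha0_def)

lemma Dop_1_normal_form: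
  assumes "m \<ge> 1"
  shows "Dop m N lam mu rho 1 phi q = Euler 1 phi q
    + lam * (\<Sum>j\<in>{2..N}. pair_op m alpha 1 j phi q) + one_op m (kappa mu rho) 1 phi q"
proof -
  have "(\<Sum>j\<in>{1..N} - {1}. pair_op m (if 1 < j then alpha else alpha0) 1 j phi q)
      = (\<Sum>j\<in>{2..N}. pair_op m alpha 1 j phi q)"
    by (rule sum.cong) auto
  then show ?thesis unfolding Dop_normal_form[OF assms] by simp
qed

locale regular_domain =
  fixes m N :: nat and U :: "(nat \<Rightarrow> complex) set"
  assumes m: "m \<ge> 1" and openU: "open U" and UReg: "U \<subseteq> Reg m N" and inv: "invariant_dom m N U"
begin

lemma nz: "q \<in> U \<Longrightarrow> i \<in> {1..N} \<Longrightarrow> q i \<noteq> 0"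
  using UReg by (auto simp: Reg_def)

lemma root_index: "g \<in> roots m \<Longrightarrow> \<exists>s<m. g = tau m ^ s"
  using bij_betw_imp_surj_on[OF bij_betw_tau_power[OF m]] by auto

lemma kappa_regular:
  assumes "q \<in> U" "i \<in> {1..N}" "g \<in> roots m"
  shows "g * q i \<noteq> inverse (g * q i)"
proof -
  obtain s where s: "s < m" "g = tau m ^ s" using root_index assms(3) by blast
  have "tau m ^ s * q i \<noteq> tau m powi (- int s) * inverse (q i)"
    using assms UReg s(1) by (auto simp: Reg_def)
  then show ?thesis by (simp add: s power_int_minus)
qed

lemma alpha_regular:
  assumes "q \<in> U" "i \<in> {1..N}" "j \<in> {1..N}" "i \<noteq> j" "c \<in> dihs m"
  shows "q i \<noteq> act c (q j)"
proof -
  have *: "q i \<noteq> tau m ^ s * q j" "q i \<noteq> tau m powi (- int s) * inverse (q j)" if "s < m" for s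
    using assms(1-4) UReg that by (auto simp: Reg_def)
  show ?thesis
  proof (cases "snd c")
    case True
    have "fst c \<in> roots m" using assms(5) by (auto simp: dihs_def)
    then obtain s where "s < m" "fst c = tau m ^ s" using root_index by blast
    then show ?thesis using *(1)[of s] True by (simp add: act_def)
  next
    case False
    \<comment> \<open>\<open>Reg\<close> lists the inversions with \<open>tau m\<close> to the power
      \<open>- int s\<close>, so the inverse of \<open>fst c\<close> is the one to be written as a
      power.\<close>
    have "inverse (fst c) \<in> roots m" using assms(5) by (auto simp: dihs_def)
    then obtain s where s: "s < m" "inverse (fst c) = tau m ^ s" using root_index by blast
    then have "fst c = tau m powi (- int s)"
      by (metis inverse_inverse_eq power_int_minus power_int_of_nat)
    then show ?thesis using *(2)[of s] False s by (simp add: act_def)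
  qed
qed

text \<open>Invariance is given for generators; powers of \<open>tau m\<close>, applied after an
  inversion if necessary, produce every dihedral substitution of one coordinate.\<close>

lemma move_U:
  assumes "q \<in> U" "i \<in> {1..N}" "c \<in> dihs m"
  shows "move i c q \<in> U"
proof -
  have inv1: "q(i := tau m * q i) \<in> U" "q(i := inverse (q i)) \<in> U" if "q \<in> U" for q
    using inv that assms(2) by (auto simp: invariant_dom_def)
  have pow: "q(i := tau m ^ s * q i) \<in> U" if "q \<in> U" for s q
  proof (induction s)
    case (Suc s)
    show ?case using inv1(1)[OF Suc] by (simp add: mult.assoc del: fun_upd_apply) (simp add: fun_upd_def)
  qed (use that in simp)
  have "fst c \<in> roots m" using assms(3) by (auto simp: dihs_def)
  then obtain s where s: "fst c = tau m ^ s" using root_index by blast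
  show ?thesis
    using pow[OF assms(1), of s] pow[OF inv1(2)[OF assms(1)], of s] s
    by (cases "snd c") (auto simp: move_def act_def)
qed

lemma reflect_U:
  assumes "q \<in> U" "i \<in> {1..N}" "j \<in> {1..N}" "i \<noteq> j" "c \<in> dihs m"
  shows "reflect i j c q \<in> U"
proof -
  have "q(i := q j, j := q i) \<in> U"
    using assms inv by (auto simp: invariant_dom_def)
  then have "move j (dinv c) (move i c (q(i := q j, j := q i))) \<in> U"
    using assms by (intro move_U) auto
  then show ?thesis
    using assms(4) by (simp add: move_def reflect_def fun_upd_twist)
qed

text \<open>With \<open>y = act c (q j)\<close>, transport by \<open>dinv c\<close> turns
  \<open>beta\<close> into \<open>y / (y - q i)\<close> for a rotation and into its complement to 1
  for an inversion. The 1 subtracted in \<open>alpha\<close> for rotations is what makes both cases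
  a pure sign times \<open>alpha\<close>.\<close>

lemma beta_eq_alpha:
  assumes "q \<in> U" "i \<in> {1..N}" "j \<in> {1..N}" "i \<noteq> j" "c \<in> dihs m"
  shows "beta c (q i) (q j) = - dsgn c * alpha c (q i) (q j)"
proof -
  have c: "fst c \<noteq> 0" using dihs_nz[OF m assms(5)] .
  define y where "y = act c (q j)"
  have y: "y \<noteq> 0" "q i \<noteq> y" "q i \<noteq> 0"
    using alpha_regular[OF assms] c nz assms by (auto simp: y_def)
  have "q j = act (dinv c) y" using c by (simp add: y_def)
  then have "beta c (q i) (q j) = act (dinv c) y / (act (dinv c) y - act (dinv c) (q i))"
    by (simp add: beta_def alpha0_def)
  also have "\<dots> = (if snd c then y / (y - q i) else 1 - y / (y - q i))"
    using alpha0_act[of "dinv c" y "q i"] c y by simp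
  also have "\<dots> = - dsgn c * (q i / (q i - y) - (if snd c then 1 else 0))"
    using y by (auto simp: dsgn_def divide_simps) (auto simp: algebra_simps)
  finally show ?thesis by (simp add: alpha_def alpha0_def y_def)
qed

end

section \<open>Passing a substitution of one coordinate through each kind of summand\<close>

lemma pair_op_cong_coeff:
  assumes "\<And>c. c \<in> dihs m \<Longrightarrow> a c (q i) (q j) = b c (q i) (q j)"
  shows "pair_op m a i j phi q = pair_op m b i j phi q"
  by (simp add: pair_op_def assms)

text \<open>Substituting in the second coordinate multiplies \<open>c\<close> by \<open>d\<close> on
  the right. The assumption on the weights asks them to follow this shift: \<open>alpha0\<close>
  does so for every \<open>d\<close>, \<open>alpha\<close> for rotations, since its subtracted 1
  depends on the type of \<open>c\<close>.\<close>

lemma pair_op_move_second: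
  assumes "m \<ge> 1" "i \<noteq> j" "d \<in> dihs m"
    and a: "\<And>c x y. c \<in> dihs m \<Longrightarrow> a c x (act d y) = a' (dmul c d) x y"
  shows "pair_op m a i j phi (move j d q) = pair_op m a' i j (\<lambda>q. phi (move j d q)) q"
proof -
  have d: "fst d \<noteq> 0" using dihs_nz assms(1,3) .
  have "pair_op m a' i j (\<lambda>q. phi (move j d q)) q
      = (\<Sum>c\<in>dihs m. a' (dmul c d) (q i) (q j) * phi (move j d (reflect i j (dmul c d) q)))"
    unfolding pair_op_def by (rule sum_dihs_dmul(2)[OF assms(1,3), symmetric])
  also have "\<dots> = pair_op m a i j phi (move j d q)"
    unfolding pair_op_def
  proof (intro sum.cong refl)
    fix c assume c: "c \<in> dihs m"
    have "move j d (reflect i j (dmul c d) q) = reflect i j c (move j d q)"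
      using assms(2) d by (simp add: move_def reflect_def fun_eq_iff)
    then show "a' (dmul c d) (q i) (q j) * phi (move j d (reflect i j (dmul c d) q)) =
        a c (move j d q i) (move j d q j) * phi (reflect i j c (move j d q))"
      using assms(2) a[OF c] by (simp add: move_def)
  qed
  finally show ?thesis ..
qed

lemma pair_op_move_first:
  assumes "m \<ge> 1" "i \<noteq> j" "d \<in> dihs m"
  shows "pair_op m a i j phi (move i d q)
    = pair_op m (\<lambda>c x y. a (dmul d c) (act d x) y) i j (\<lambda>q. phi (move i d q)) q"
proof -
  have d: "fst d \<noteq> 0" using dihs_nz assms(1,3) .
  have "pair_op m a i j phi (move i d q)
      = (\<Sum>c\<in>dihs m. a (dmul d c) (act d (q i)) (q j) * phi (reflect i j (dmul d c) (move i d q)))"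
    unfolding pair_op_def using assms(2)
    by (subst sum_dihs_dmul(1)[OF assms(1,3), symmetric]) (simp add: move_def)
  moreover have "reflect i j (dmul d c) (move i d q) = move i d (reflect i j c q)" for c
    using assms(2) d by (simp add: move_def reflect_def fun_eq_iff)
  ultimately show ?thesis by (simp add: pair_op_def)
qed

lemma pair_op_move_other:
  assumes "k \<noteq> i" "k \<noteq> j"
  shows "pair_op m a i j phi (move k d q) = pair_op m a i j (\<lambda>q. phi (move k d q)) q"
  using assms by (auto simp: pair_op_def move_def reflect_def fun_upd_twist intro!: sum.cong arg_cong[of _ _ phi])

lemma one_op_move_other:
  assumes "k \<noteq> i"
  shows "one_op m b i phi (move k d q) = one_op m b i (\<lambda>q. phi (move k d q)) q"
  using assms by (auto simp: one_op_def move_def fun_upd_twist intro!: sum.cong arg_cong[of _ _ phi])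

lemma Euler_eqI:
  assumes "((\<lambda>z. phi (q(i := z))) has_field_derivative d) (at (q i))"
  shows "Euler i phi q = q i * d"
  using DERIV_imp_deriv[OF assms] by (simp add: Euler_def)

lemma Euler_move_other:
  assumes "k \<noteq> i"
  shows "Euler i phi (move k d q) = Euler i (\<lambda>q. phi (move k d q)) q"
  using assms by (simp add: Euler_def move_def fun_upd_twist)

lemma DERIV_act:
  assumes "z \<noteq> 0"
  shows "(act c has_field_derivative dsgn c * act c z / z) (at z)"
  using assms unfolding act_def[abs_def] dsgn_def
  by (cases "snd c") (auto intro!: derivative_eq_intros simp: power2_eq_square field_simps)

text \<open>The Euler derivative is logarithmic, so a dihedral substitution contributes only the
  factor \<open>dsgn c\<close>. An abstract \<open>w\<close> serves both \<open>move\<close>, where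
  \<open>j = i\<close>, and \<open>reflect\<close>, where coordinate \<open>i\<close> of the
  argument is carried to coordinate \<open>j\<close> of the image.\<close>

lemma Euler_chain:
  assumes "q i \<noteq> 0" and upd: "\<And>z. w (q(i := z)) = (w q)(j := act c z)"
    and wq: "w q j = act c (q i)"
    and d: "(\<lambda>z. phi ((w q)(j := z))) field_differentiable (at (w q j))"
  shows "Euler i (\<lambda>q. phi (w q)) q = dsgn c * Euler j phi (w q)"
    and "(\<lambda>z. phi (w (q(i := z)))) field_differentiable (at (q i))"
proof -
  obtain e where e: "((\<lambda>z. phi ((w q)(j := z))) has_field_derivative e) (at (w q j))"
    using d field_differentiable_def by blast
  have "((\<lambda>z. phi ((w q)(j := act c z))) has_field_derivative e * (dsgn c * act c (q i) / q i)) (at (q i))"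
    by (rule DERIV_chain2[where g = "act c", OF _ DERIV_act[OF assms(1)]]) (use e wq in \<open>simp only:\<close>)
  then have *: "((\<lambda>z. phi (w (q(i := z)))) has_field_derivative e * (dsgn c * act c (q i) / q i)) (at (q i))"
    by (simp only: upd)
  show "Euler i (\<lambda>q. phi (w q)) q = dsgn c * Euler j phi (w q)"
    using Euler_eqI[OF *] Euler_eqI[OF e] wq assms(1) by simp
  show "(\<lambda>z. phi (w (q(i := z)))) field_differentiable (at (q i))"
    using * field_differentiable_def by blast
qed

context regular_domain
begin

lemma Euler_move:
  assumes "q \<in> U" "i \<in> {1..N}" "c \<in> dihs m" "holo_on N U phi"
  shows "Euler i (\<lambda>q. phi (move i c q)) q = dsgn c * Euler i phi (move i c q)"
proof (rule Euler_chain(1))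
  show "(\<lambda>z. phi ((move i c q)(i := z))) field_differentiable at (move i c q i)"
    using assms(2,4) move_U[OF assms(1-3)] by (auto simp: holo_on_def)
qed (use nz[OF assms(1,2)] in \<open>auto simp: move_def\<close>)

lemma tau_dih: "(tau m, True) \<in> dihs m" "(1, e) \<in> dihs m"
  using tau_power_root[OF m, of 1] by (auto simp: dihs_def)

lemma Dop_Q1:
  assumes "q \<in> U" "N \<ge> 1" "holo_on N U psi"
  shows "Qpow m 1 1 (Dop m N lam mu rho 1 psi) q = Dop m N lam mu rho 1 (Qpow m 1 1 psi) q"
proof -
  define t where "t = (tau m, True)"
  have t: "t \<in> dihs m" "fst t \<noteq> 0" "snd t" "fst t \<in> roots m"
    using tau_dih(1) dihs_nz[OF m tau_dih(1)] by (auto simp: t_def dihs_def)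
  have Q: "Qpow m 1 1 phi = (\<lambda>q. phi (move 1 t q))" for phi
    by (auto simp: Qpow_def move_def t_def act_def)
  have i: "1 \<in> {1..N}" using assms by simp
  have E: "Euler 1 psi (move 1 t q) = Euler 1 (\<lambda>q. psi (move 1 t q)) q"
    using Euler_move[OF assms(1) i t(1) assms(3)] t by (simp add: dsgn_def)
  have P: "pair_op m alpha 1 j psi (move 1 t q)
      = pair_op m alpha 1 j (\<lambda>q. psi (move 1 t q)) q"
    if "j \<in> {2..N}" for j
  proof (subst pair_op_move_first[OF m _ t(1)], use that in simp, rule pair_op_cong_coeff)
    fix c assume "c \<in> dihs m"
    then show "alpha (dmul t c) (act t (q 1)) (q j)
        = alpha c (q 1) (q j)"
      using alpha_regular[OF assms(1) i, of j c] nz[OF assms(1)] that t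
        alpha0_dmul[of t c "q 1" "q j"] dihs_nz[OF m \<open>c \<in> dihs m\<close>] i
      by (simp add: alpha_def)
  qed
  have M: "one_op m (kappa mu rho) 1 psi (move 1 t q) = one_op m (kappa mu rho) 1 (\<lambda>q. psi (move 1 t q)) q"
  proof -
    \<comment> \<open>A rotation by \<open>t\<close> moves past an inversion at the cost of
      multiplying its root by \<open>fst t\<close>. As \<open>kappa\<close> sees only the product of
      root and coordinate, translating the root matches the weights.\<close>
    have *: "move (Suc 0) (rot g) (move (Suc 0) t q) = move (Suc 0) t (move (Suc 0) (rot (fst t * g)) q)" for g
      using t by (simp add: move_def rot_conv fun_eq_iff power2_eq_square) (simp add: act_def)
    have "one_op m (kappa mu rho) 1 (\<lambda>q. psi (move 1 t q)) q
      = (\<Sum>g\<in>roots m. kappa mu rho (fst t * g) (q 1) * psi (move 1 t (move 1 (rot (fst t * g)) q)))"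
      unfolding one_op_def by (rule sum_roots_mult[OF m t(4), symmetric])
    also have "\<dots> = one_op m (kappa mu rho) 1 psi (move 1 t q)"
      unfolding one_op_def
    proof (intro sum.cong refl)
      fix g
      have "move 1 t q 1 = fst t * q 1" using t by (simp add: move_def act_def)
      then show "kappa mu rho (fst t * g) (q 1) * psi (move 1 t (move 1 (rot (fst t * g)) q))
          = kappa mu rho g (move 1 t q 1) * psi (move 1 (rot g) (move 1 t q))"
        by (simp add: * kappa_mult mult.commute)
    qed
    finally show ?thesis ..
  qed
  show ?thesis
    unfolding Q Dop_1_normal_form[OF m] E M by (simp add: P del: One_nat_def)
qed

lemma Dop_K1:
  assumes "q \<in> U" "N \<ge> 1" "holo_on N U psi"
  shows "Kop 1 (Dop m N lam mu rho 1 psi) q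
    = - Dop m N lam mu rho 1 (Kop 1 psi) q + mu * (\<Sum>s<m. Qpow m 1 (2 * int s) psi q)"
proof -
  define k :: dih where "k = (1, False)"
  have k: "k \<in> dihs m" "fst k \<noteq> 0" "\<not> snd k"
    using tau_dih dihs_nz[OF m] by (auto simp: k_def dihs_def)
  have K: "Kop 1 phi = (\<lambda>q. phi (move 1 k q))" for phi
    by (auto simp: Kop_def move_def k_def act_def)
  have i: "1 \<in> {1..N}" using assms by simp
  have E: "Euler 1 psi (move 1 k q) = - Euler 1 (\<lambda>q. psi (move 1 k q)) q"
    using Euler_move[OF assms(1) i k(1) assms(3)] k by (simp add: dsgn_def)
  have P: "pair_op m alpha 1 j psi (move 1 k q)
      = - pair_op m alpha 1 j (\<lambda>q. psi (move 1 k q)) q"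
    if j: "j \<in> {2..N}" for j
  proof -
    \<comment> \<open>Inversion turns \<open>alpha0\<close> into \<open>1 - alpha0\<close> and
      exchanges rotations with inversions, so the subtracted 1 moves to the other type; together
      this gives \<open>- alpha\<close>.\<close>
    have *: "alpha (dmul k c) (act k (q 1)) (q j) = - alpha c (q 1) (q j)" if c: "c \<in> dihs m" for c
      using alpha_regular[OF assms(1) i, of j c] nz[OF assms(1)] j k c
        alpha0_dmul[of k c "q 1" "q j"] dihs_nz[OF m c] i
      by (simp add: alpha_def)
    have "1 \<noteq> j" using j by auto
    have "pair_op m alpha 1 j psi (move 1 k q)
      = pair_op m (\<lambda>c x y. - alpha c x y) 1 j (\<lambda>q. psi (move 1 k q)) q"
      unfolding pair_op_move_first[OF m \<open>1 \<noteq> j\<close> k(1)] by (rule pair_op_cong_coeff) (rule *)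
    then show ?thesis by (simp add: pair_op_def sum_negf)
  qed
  have M: "one_op m (kappa mu rho) 1 psi (move 1 k q)
      = - one_op m (kappa mu rho) 1 (\<lambda>q. psi (move 1 k q)) q + mu * (\<Sum>s<m. Qpow m 1 (2 * int s) psi q)"
  proof -
    \<comment> \<open>Inversion combined with \<open>rot (inverse g)\<close> multiplies the
      coordinate by the square of \<open>g\<close>; these are the substitutions in the extra sum
      with factor \<open>mu\<close>.\<close>
    define F where "F = (\<lambda>g. psi (q(1 := g\<^sup>2 * q 1)))"
    have "tau m powi (2 * int s) = (tau m ^ s)\<^sup>2" for s
      by (simp add: power_int_def nat_mult_distrib mult.commute flip: power_mult)
    then have 1: "(\<Sum>s<m. Qpow m 1 (2 * int s) psi q) = (\<Sum>g\<in>roots m. F g)"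
      by (simp add: Qpow_def F_def sum_tau_power[OF m, where H = "\<lambda>g. psi (q(Suc 0 := g\<^sup>2 * q (Suc 0)))"])
    have 2: "one_op m (kappa mu rho) 1 (\<lambda>q. psi (move 1 k q)) q = (\<Sum>g\<in>roots m. kappa mu rho g (q 1) * F g)"
      unfolding one_op_def F_def by (simp add: move_def rot_conv) (simp add: act_def k_def)
    have "one_op m (kappa mu rho) 1 psi (move 1 k q)
      = (\<Sum>g\<in>roots m. kappa mu rho (inverse g) (inverse (q 1)) * psi (move 1 (rot (inverse g)) (move 1 k q)))"
      unfolding one_op_def
      by (subst sum_roots_inverse[symmetric]) (simp add: move_def act_def k_def)
    also have "\<dots> = (\<Sum>g\<in>roots m. (mu - kappa mu rho g (q 1)) * F g)"
    proof (intro sum.cong refl)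
      fix g assume g: "g \<in> roots m"
      have "move 1 (rot (inverse g)) (move 1 k q) = q(1 := g\<^sup>2 * q 1)"
        by (simp add: move_def rot_conv) (simp add: act_def k_def power_inverse)
      then show "kappa mu rho (inverse g) (inverse (q 1)) * psi (move 1 (rot (inverse g)) (move 1 k q))
          = (mu - kappa mu rho g (q 1)) * F g"
        using kappa_inverse[OF roots_nz[OF m g] nz[OF assms(1) i] kappa_regular[OF assms(1) i g], of mu rho]
        by (simp add: F_def)
    qed
    finally show ?thesis unfolding 1 2 by (simp add: left_diff_distrib sum_subtractf sum_distrib_left)
  qed
  show ?thesis
    unfolding K Dop_1_normal_form[OF m] E M by (simp add: P sum_negf del: One_nat_def)
qed

end

lemma Dop_Q2:
  assumes "m \<ge> 1" "N \<ge> 2"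
  shows "Dop m N lam mu rho 1 (Qpow m 2 1 psi) q = Qpow m 2 1 (Dop m N lam mu rho 1 psi) q"
proof -
  define t where "t = (tau m, True)"
  have t: "t \<in> dihs m" "snd t" using tau_power_root[OF assms(1), of 1] by (auto simp: t_def dihs_def)
  have Q: "Qpow m 2 1 phi = (\<lambda>q. phi (move 2 t q))" for phi
    by (auto simp: Qpow_def move_def t_def act_def)
  have "pair_op m alpha 1 j psi (move 2 t q)
      = pair_op m alpha 1 j (\<lambda>q. psi (move 2 t q)) q"
    if "j \<in> {2..N}" for j
  proof (cases "j = 2")
    case True
    show ?thesis unfolding True
      by (rule pair_op_move_second[OF assms(1) _ t(1)]) (use t in \<open>auto simp: alpha_def alpha0_def\<close>)
  qed (rule pair_op_move_other, use that in auto)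
  then show ?thesis
    unfolding Q Dop_1_normal_form[OF assms(1)]
    by (simp add: Euler_move_other one_op_move_other del: One_nat_def)
qed

text \<open>The added sum cancels the subtracted 1 for the pair 1, 2 and leaves
  \<open>alpha0\<close>, which is compatible with every dihedral substitution of coordinate 2,
  inversion included. This is its role in the relation with \<open>Kop 2\<close>.\<close>

lemma reduced_Dop:
  assumes "m \<ge> 1" "N \<ge> 2"
  shows "Dop m N lam mu rho 1 phi q + lam * (\<Sum>s<m. Qpow m 1 (- int s) (Pop 1 2 (Qpow m 1 (int s) phi)) q)
    = Euler 1 phi q + lam * (pair_op m alpha0 1 2 phi q + (\<Sum>j\<in>{3..N}. pair_op m alpha 1 j phi q))
      + one_op m (kappa mu rho) 1 phi q"
proof -
  have 1: "(\<Sum>s<m. Qpow m 1 (- int s) (Pop 1 2 (Qpow m 1 (int s) phi)) q)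
      = (\<Sum>c\<in>dihs m. (if snd c then 1 else 0) * phi (reflect 1 2 c q))"
    by (simp add: Qpow_Pop_Qpow sum_dihs[OF assms(1)] del: One_nat_def)
      (rule sum_tau_power[OF assms(1)])
  have 2: "{2..N} = insert 2 {3..N}" using assms by auto
  have "(\<Sum>j\<in>{2..N}. pair_op m alpha 1 j phi q)
      = pair_op m alpha 1 2 phi q + (\<Sum>j\<in>{3..N}. pair_op m alpha 1 j phi q)"
    unfolding 2 by simp
  moreover have "pair_op m alpha 1 2 phi q = pair_op m alpha0 1 2 phi q
      - (\<Sum>c\<in>dihs m. (if snd c then 1 else 0) * phi (reflect 1 2 c q))"
    by (simp add: pair_op_def alpha_def left_diff_distrib sum_subtractf)
  ultimately show ?thesis
    unfolding Dop_1_normal_form[OF assms(1)] 1 by (simp add: right_diff_distrib distrib_left)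
qed

lemma reduced_Dop_K2:
  fixes lam mu rho :: complex
  assumes "m \<ge> 1" "N \<ge> 2"
  defines "A \<equiv> \<lambda>phi q. Dop m N lam mu rho 1 phi q
    + lam * (\<Sum>s<m. Qpow m 1 (- int s) (Pop 1 2 (Qpow m 1 (int s) phi)) q)"
  shows "A (Kop 2 psi) q = Kop 2 (A psi) q"
proof -
  define k :: dih where "k = (1, False)"
  have k: "k \<in> dihs m" by (auto simp: k_def dihs_def)
  have K: "Kop 2 phi = (\<lambda>q. phi (move 2 k q))" for phi
    by (auto simp: Kop_def move_def k_def act_def)
  have "pair_op m alpha0 1 2 psi (move 2 k q) = pair_op m alpha0 1 2 (\<lambda>q. psi (move 2 k q)) q"
    by (rule pair_op_move_second[OF assms(1) _ k]) (auto simp: alpha0_def)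
  moreover have "(\<Sum>j\<in>{3..N}. pair_op m alpha 1 j psi (move 2 k q))
      = (\<Sum>j\<in>{3..N}. pair_op m alpha 1 j (\<lambda>q. psi (move 2 k q)) q)"
    by (intro sum.cong refl pair_op_move_other) auto
  ultimately show ?thesis
    unfolding K A_def reduced_Dop[OF assms(1,2)]
    by (simp add: Euler_move_other one_op_move_other del: One_nat_def)
qed

section \<open>Conjugation by permutations of the coordinates\<close>

lemma pair_op_permute:
  assumes "p permutes S" "i \<noteq> j"
  shows "pair_op m a i j (\<lambda>q. phi (q \<circ> p)) (q \<circ> inv p) = pair_op m a (inv p i) (inv p j) phi q"
proof -
  have *: "reflect i j c (q \<circ> inv p) \<circ> p = reflect (inv p i) (inv p j) c q" for c
    using assms permutes_inverses[OF assms(1)] by (auto simp: reflect_def fun_eq_iff)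
  show ?thesis unfolding pair_op_def * by simp
qed

lemma one_op_permute:
  assumes "p permutes S"
  shows "one_op m b i (\<lambda>q. phi (q \<circ> p)) (q \<circ> inv p) = one_op m b (inv p i) phi q"
proof -
  have *: "move i c (q \<circ> inv p) \<circ> p = move (inv p i) c q" for c
    using permutes_inverses[OF assms(1)] by (auto simp: move_def fun_eq_iff)
  show ?thesis unfolding one_op_def * by simp
qed

lemma Euler_permute:
  assumes "p permutes S"
  shows "Euler i (\<lambda>q. phi (q \<circ> p)) (q \<circ> inv p) = Euler (inv p i) phi q"
proof -
  have *: "(q \<circ> inv p)(i := z) \<circ> p = q(inv p i := z)" for z
    using permutes_inverses[OF assms(1)] by (auto simp: fun_eq_iff)
  show ?thesis unfolding Euler_def * by simp
qed

lemma Pop_permute: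
  "Pop i j phi = (\<lambda>q. phi (q \<circ> Transposition.transpose i j))"
  by (auto simp: Pop_def Transposition.transpose_def fun_eq_iff intro!: arg_cong[of _ _ phi])

text \<open>Conjugation relabels the coordinates, but the choice between \<open>alpha\<close> and
  \<open>alpha0\<close> is still made by the original order \<open>l < j\<close>, not by the order
  of the images.\<close>

lemma Pop_Dop_Pop:
  assumes "m \<ge> 1"
  shows "Pop i k (Dop m N lam mu rho l (Pop i k phi)) q = Euler (Transposition.transpose i k l) phi q
    + lam * (\<Sum>j\<in>{1..N} - {l}. pair_op m (if l < j then alpha else alpha0) (Transposition.transpose i k l) (Transposition.transpose i k j) phi q)
    + one_op m (kappa mu rho) (Transposition.transpose i k l) phi q"
proof -
  have p: "Transposition.transpose i k permutes UNIV" by (rule permutes_swap_id) auto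
  have "inv (Transposition.transpose i k) = Transposition.transpose i k" by simp
  note * = pair_op_permute[OF p, unfolded this] one_op_permute[OF p, unfolded this]
    Euler_permute[OF p, unfolded this]
  have "(\<Sum>j\<in>{1..N} - {l}. pair_op m (if l < j then alpha else alpha0) l j (\<lambda>q. phi (q \<circ> Transposition.transpose i k)) (q \<circ> Transposition.transpose i k))
    = (\<Sum>j\<in>{1..N} - {l}. pair_op m (if l < j then alpha else alpha0) (Transposition.transpose i k l) (Transposition.transpose i k j) phi q)"
    by (intro sum.cong refl *) auto
  then show ?thesis
    unfolding Pop_permute Dop_normal_form[OF assms] * by simp
qed

lemma Dop_Pop_commute:
  assumes "m \<ge> 1" "1 < j" "j \<le> N - 1"
  shows "Pop j (j+1) (Dop m N lam mu rho 1 psi) q = Dop m N lam mu rho 1 (Pop j (j+1) psi) q"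
proof -
  define t where "t = Transposition.transpose j (Suc j)"
  \<comment> \<open>\<open>Pop\<close> is an involution; writing \<open>psi\<close> as the exchange
    of \<open>psi'\<close> turns the one-sided exchange into a conjugation.\<close>
  define psi' where "psi' = Pop j (j+1) psi"
  have tt: "t (t x) = x" for x by (simp add: t_def)
  have "Pop j (j+1) psi' = psi"
    unfolding psi'_def Pop_permute by (simp add: comp_assoc)
  then have "Pop j (j+1) (Dop m N lam mu rho 1 psi) q
      = Pop j (j+1) (Dop m N lam mu rho 1 (Pop j (j+1) psi')) q" by simp
  also have "\<dots> = Euler 1 psi' q
    + lam * (\<Sum>k\<in>{1..N} - {1}. pair_op m (if 1 < k then alpha else alpha0) 1 (t k) psi' q)
    + one_op m (kappa mu rho) 1 psi' q"
    unfolding Pop_Dop_Pop[OF assms(1)] using assms(2)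
    by (simp add: t_def transpose_apply_other)
  also have "(\<Sum>k\<in>{1..N} - {1}. pair_op m (if 1 < k then alpha else alpha0) 1 (t k) psi' q)
      = (\<Sum>k\<in>{1..N} - {1}. pair_op m (if 1 < k then alpha else alpha0) 1 k psi' q)"
    by (rule sum.reindex_bij_witness[where i = t and j = t])
      (use assms in \<open>auto simp: t_def Transposition.transpose_def\<close>)
  finally show ?thesis
    unfolding Dop_normal_form[OF assms(1)] psi'_def .
qed

text \<open>One reflection read from either end: \<open>reflect i j (dinv c)\<close> is
  \<open>reflect j i c\<close>.\<close>

lemma pair_op_flip:
  "i \<noteq> j \<Longrightarrow> pair_op m (\<lambda>c x y. a (dinv c) y x) i j phi q = pair_op m a j i phi q"
  unfolding pair_op_def
  by (subst (2) sum_dihs_dinv[symmetric]) (simp add: reflect_def fun_upd_twist)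

text \<open>Every index other than \<open>i\<close> and \<open>i + 1\<close> lies on the same side
  of both, so conjugation gives the correct weight to all pairs except \<open>i + 1\<close>,
  \<open>i\<close>, which carries \<open>alpha\<close> instead of \<open>alpha0\<close>. The added
  sum over rotations makes up the difference.\<close>

lemma Dop_Suc:
  assumes "m \<ge> 1" "i \<in> {1..N-1}"
  shows "Dop m N lam mu rho (i+1) psi q = Pop i (i+1) (Dop m N lam mu rho i (Pop i (i+1) psi)) q
         + lam * (\<Sum>s<m. Qpow m i (int s) (Pop i (i+1) (Qpow m i (- int s) psi)) q)"
proof -
  define t where "t = Transposition.transpose i (Suc i)"
  define S where "S = (\<Sum>c\<in>dihs m. (if snd c then 1 else 0) * psi (reflect (Suc i) i c q))"
  have 1: "(\<Sum>s<m. Qpow m i (int s) (Pop i (i+1) (Qpow m i (- int s) psi)) q) = S"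
  proof -
    have "reflect i (Suc i) (inverse g, True) q = reflect (Suc i) i (g, True) q" for g
      by (simp add: reflect_def fun_upd_twist)
    then show ?thesis
      by (simp add: Qpow_Pop_Qpow S_def sum_dihs[OF assms(1)])
        (rule sum_tau_power[OF assms(1)])
  qed
  have 2: "{1..N} - {i} = insert (Suc i) ({1..N} - {i, Suc i})"
      "{1..N} - {Suc i} = insert i ({1..N} - {i, Suc i})"
    using assms(2) by auto
  have 3: "pair_op m (if i < j then alpha else alpha0) (Suc i) (t j) psi q
      = pair_op m (if Suc i < j then alpha else alpha0) (Suc i) j psi q" if "j \<in> {1..N} - {i, Suc i}" for j
    using that by (auto simp: t_def Transposition.transpose_def)
  have 4: "pair_op m alpha (Suc i) i psi q = pair_op m alpha0 (Suc i) i psi q - S"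
    by (simp add: pair_op_def alpha_def S_def left_diff_distrib sum_subtractf)
  show ?thesis
    unfolding Pop_Dop_Pop[OF assms(1)] 1 unfolding Dop_normal_form[OF assms(1)] Suc_eq_plus1[symmetric] 2 t_def[symmetric]
    using 3 by (simp add: t_def 4 algebra_simps)
qed

section \<open>Commutation of products of substitutions\<close>

lemma pair_op_linear:
  "pair_op m a i j (\<lambda>q. f q + g q) q = pair_op m a i j f q + pair_op m a i j g q"
  "pair_op m a i j (\<lambda>q. k * f q) q = k * pair_op m a i j f q"
  "pair_op m a i j (\<lambda>q. \<Sum>x\<in>A. F x q) q = (\<Sum>x\<in>A. pair_op m a i j (F x) q)"
  by (simp_all add: pair_op_def distrib_left sum.distrib sum_distrib_left mult_ac sum.swap[of _ A])

lemma one_op_linear: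
  "one_op m b i (\<lambda>q. f q + g q) q = one_op m b i f q + one_op m b i g q"
  "one_op m b i (\<lambda>q. k * f q) q = k * one_op m b i f q"
  "one_op m b i (\<lambda>q. \<Sum>x\<in>A. F x q) q = (\<Sum>x\<in>A. one_op m b i (F x) q)"
  by (simp_all add: one_op_def distrib_left sum.distrib sum_distrib_left mult_ac sum.swap[of _ A])

lemma pair_pair_disjoint:
  assumes "{i, j} \<inter> {k, l} = {}"
  shows "pair_op m a i j (pair_op m b k l phi) q = pair_op m b k l (pair_op m a i j phi) q"
proof -
  have "reflect k l d (reflect i j c q) = reflect i j c (reflect k l d q)" for c d
    using assms by (simp add: reflect_def fun_upd_twist)
  then show ?thesis
    using assms unfolding pair_op_def sum_distrib_left
    by (subst sum.swap) (simp add: reflect_def mult_ac)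
qed

lemma pair_one_disjoint:
  assumes "k \<notin> {i, j}"
  shows "pair_op m a i j (one_op m b k phi) q = one_op m b k (pair_op m a i j phi) q"
proof -
  have "move k d (reflect i j c q) = reflect i j c (move k d q)" for c d
    using assms by (simp add: reflect_def move_def fun_upd_twist)
  then show ?thesis
    using assms unfolding pair_op_def one_op_def sum_distrib_left
    by (subst sum.swap) (simp add: reflect_def move_def mult_ac)
qed

lemma one_one_disjoint:
  assumes "i \<noteq> k"
  shows "one_op m a i (one_op m b k phi) q = one_op m b k (one_op m a i phi) q"
proof -
  have "move k d (move i c q) = move i c (move k d q)" for c d
    using assms by (simp add: move_def fun_upd_twist)
  then show ?thesis
    using assms unfolding one_op_def sum_distrib_left
    by (subst sum.swap) (simp add: move_def mult_ac)
qed

text \<open>The weight of the inversion \<open>d\<close> depends on \<open>x\<close>,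
  \<open>y\<close> only through \<open>x * y\<close>, which the reflection of the rotation
  \<open>c\<close> preserves; the weight of \<open>c\<close> depends only on \<open>x / y\<close>,
  which the reflection of \<open>d\<close> preserves. So each weight is unaffected by the other
  reflection.\<close>

lemma two_body_identity:
  assumes "x \<noteq> 0" "y \<noteq> 0" "x \<noteq> act c y" "x \<noteq> act d y" "fst c \<noteq> 0" "fst d \<noteq> 0" "snd c" "\<not> snd d"
  shows "alpha c x y * alpha d (act c y) (act (dinv c) x) = alpha d x y * alpha c (act d y) (act (dinv d) x)"
proof -
  define g h where "g = fst c" and "h = fst d"
  have *: "g \<noteq> 0" "h \<noteq> 0" "x \<noteq> g * y" "x * y \<noteq> h"
    using assms by (auto simp: g_def h_def act_def field_simps)
  have "alpha d (act c y) (act (dinv c) x) = x * y / (x * y - h)"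
    "alpha d x y = x * y / (x * y - h)"
    using * assms by (simp_all add: alpha_def alpha0_def act_def dinv_def g_def[symmetric] h_def[symmetric])
      (simp_all add: field_simps)
  moreover have "alpha c (act d y) (act (dinv d) x) = alpha c x y"
    using * assms by (simp add: alpha_def alpha0_def act_def dinv_def g_def[symmetric] h_def[symmetric])
      (simp add: divide_simps, simp add: algebra_simps)
  ultimately show ?thesis by simp
qed

text \<open>A partial fraction identity in three points. The flags \<open>e\<close> and
  \<open>f\<close> say whether \<open>c\<close> and \<open>d\<close> are rotations: inversions
  replace a fraction by its complement to 1, and only rotations carry the subtracted 1.\<close>

lemma three_body_identity_1:
  fixes X Y Z :: complex
  assumes "X \<noteq> Y" "X \<noteq> Z" "Y \<noteq> Z"
  shows "(X / (X - Y) - (if e then 1 else 0)) * ((if e then X / (X - Z) else 1 - X / (X - Z)) - (if f then 1 else 0))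
    + (X / (X - Z) - (if e = f then 1 else 0)) * (- (if e then 1 else - 1) * (Z / (Z - Y) - (if e then 1 else 0)))
    = ((if e then Y / (Y - Z) else 1 - Y / (Y - Z)) - (if f then 1 else 0)) * (X / (X - Y) - (if e = f then 1 else 0))"
  using assms by (cases e; cases f; simp add: divide_simps; simp add: algebra_simps)

text \<open>The counterpart for the other 3-cycle; here \<open>e\<close> is the type of
  \<open>d\<close> and \<open>f\<close> the type of \<open>c\<close>.\<close>

lemma three_body_identity_2:
  fixes X Y Z :: complex
  assumes "X \<noteq> Y" "X \<noteq> Z" "Y \<noteq> Z"
  shows "(X / (X - Z) - (if f then 1 else 0)) * ((if e then Y / (Y - X) else 1 - Y / (Y - X)) - (if e = f then 1 else 0))
    = ((if e then Y / (Y - Z) else 1 - Y / (Y - Z)) - (if e = f then 1 else 0)) * (X / (X - Z) - (if e then 1 else 0))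
      + (- (if e then 1 else - 1) * (X / (X - Y) - (if e then 1 else 0))) * (Y / (Y - Z) - (if f then 1 else 0))"
  using assms by (cases e; cases f; simp add: divide_simps; simp add: algebra_simps)

text \<open>The case of a rotation \<open>c\<close>, in coordinates where both one-body
  substitutions are plain inversions; \<open>mu - k Y\<close> stands for
  \<open>k (inverse Y)\<close>. The next identity is the case of an inversion
  \<open>c\<close>.\<close>

lemma one_body_identity_1:
  fixes X Y mu rho :: complex
  assumes "X \<noteq> 0" "Y \<noteq> 0" "X \<noteq> Y" "X * Y \<noteq> 1" "X * X \<noteq> 1" "Y * Y \<noteq> 1"
  defines "k \<equiv> kappa mu rho 1"
  shows "(X / (X - Y) - 1) * k X + k X * (- (inverse X / (inverse X - Y) - 1))
    = k Y * (X / (X - Y)) + X / (X - inverse Y) * (mu - k Y)"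
proof -
  have k: "k x = (mu * x - rho) * x / (x * x - 1)" if "x \<noteq> 0" for x
    using that by (simp add: k_def kappa_def divide_simps)
  show ?thesis
    unfolding k[OF assms(1)] k[OF assms(2)] using assms(1-6)
    by (simp add: divide_simps) (simp add: algebra_simps)
qed

lemma one_body_identity_2:
  fixes X Y mu rho :: complex
  assumes "X \<noteq> 0" "Y \<noteq> 0" "X \<noteq> Y" "X * Y \<noteq> 1" "X * X \<noteq> 1" "Y * Y \<noteq> 1"
  defines "k \<equiv> kappa mu rho 1"
  shows "X / (X - inverse Y) * (mu - k X) + k X * (inverse X / (inverse X - inverse Y))
    = k Y * (X / (X - inverse Y) - 1) - (X / (X - Y) - 1) * k Y"
proof -
  have k: "k x = (mu * x - rho) * x / (x * x - 1)" if "x \<noteq> 0" for x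
    using that by (simp add: k_def kappa_def divide_simps)
  show ?thesis
    unfolding k[OF assms(1)] k[OF assms(2)] using assms(1-6)
    by (simp add: divide_simps) (simp add: algebra_simps)
qed

context regular_domain
begin

lemma two_body:
  assumes q: "q \<in> U" and i: "i \<in> {1..N}" "k \<in> {1..N}" "i \<noteq> k"
  shows "pair_op m alpha i k (pair_op m beta i k phi) q = pair_op m beta i k (pair_op m alpha i k phi) q"
proof -
  define x y where "x = q i" and "y = q k"
  define Z where "Z = (\<lambda>c d. q(i := act d (act (dinv c) x), k := act (dinv d) (act c y)))"
  define P where "P = (\<lambda>c d. alpha c x y * alpha d (act c y) (act (dinv c) x))"
  have fc: "fst c \<noteq> 0" if "c \<in> dihs m" for c using dihs_nz[OF m that] .
  have refl2: "reflect i k d (reflect i k c q) = Z c d" for c d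
    using i(3) by (simp add: reflect_def Z_def x_def y_def fun_upd_twist)
  have at: "reflect i k c q i = act c y" "reflect i k c q k = act (dinv c) x" for c
    using i(3) by (simp_all add: reflect_def x_def y_def)
  have b1: "beta c x y = - dsgn c * alpha c x y" if "c \<in> dihs m" for c
    unfolding x_def y_def by (rule beta_eq_alpha[OF q i that])
  have b2: "beta d (act c y) (act (dinv c) x) = - dsgn d * alpha d (act c y) (act (dinv c) x)"
    if "c \<in> dihs m" "d \<in> dihs m" for c d
    using beta_eq_alpha[OF reflect_U[OF q i that(1)] i that(2)] by (simp add: at)
  have 1: "pair_op m alpha i k (pair_op m beta i k phi) q
      = (\<Sum>c\<in>dihs m. \<Sum>d\<in>dihs m. - dsgn d * P c d * phi (Z c d))"
    unfolding pair_op_def sum_distrib_left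
    by (intro sum.cong refl) (simp add: refl2 at b2 P_def x_def[symmetric] y_def[symmetric])
  have 2: "pair_op m beta i k (pair_op m alpha i k phi) q
      = (\<Sum>c\<in>dihs m. \<Sum>d\<in>dihs m. - dsgn c * P c d * phi (Z c d))"
    unfolding pair_op_def sum_distrib_left
    by (intro sum.cong refl) (simp add: refl2 at b1 P_def x_def[symmetric] y_def[symmetric])
  have sym: "P c d * phi (Z c d) = P d c * phi (Z d c)"
    if c: "c \<in> dihs m" and d: "d \<in> dihs m" and s: "snd c" "\<not> snd d" for c d
  proof -
    \<comment> \<open>The reflections fixing \<open>x = g * y\<close> and \<open>x * y = h\<close>
      belong to orthogonal roots and commute.\<close>
    have "Z c d = Z d c"
      using s by (simp add: Z_def act_def dinv_def mult_ac)
    moreover have "P c d = P d c"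
      unfolding P_def
      by (rule two_body_identity)
        (use s fc c d nz[OF q] i alpha_regular[OF q i] in \<open>auto simp: x_def y_def\<close>)
    ultimately show ?thesis by simp
  qed
  \<comment> \<open>Expressing \<open>beta\<close> by \<open>alpha\<close> leaves the factor
    \<open>dsgn c - dsgn d\<close>. It vanishes for equal types; for opposite types it is
    antisymmetric while \<open>P\<close> times the value at \<open>Z\<close> is symmetric.\<close>
  have "- dsgn d * P c d * phi (Z c d) - - dsgn c * P c d * phi (Z c d)
      = - (- dsgn c * P d c * phi (Z d c) - - dsgn d * P d c * phi (Z d c))"
    if "c \<in> dihs m" "d \<in> dihs m" for c d
  proof (cases "snd c = snd d")
    case False
    then have "P c d * phi (Z c d) = P d c * phi (Z d c)"
      using sym[OF that] sym[OF that(2,1)] by metis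
    then show ?thesis by (simp add: mult.assoc)
  qed (simp add: dsgn_def)
  then have "(\<Sum>c\<in>dihs m. \<Sum>d\<in>dihs m. - dsgn d * P c d * phi (Z c d) - - dsgn c * P c d * phi (Z c d))
      = - (\<Sum>c\<in>dihs m. \<Sum>d\<in>dihs m. - dsgn c * P d c * phi (Z d c) - - dsgn d * P d c * phi (Z d c))"
    unfolding sum_negf[symmetric] by (intro sum.cong refl)
  also have "(\<Sum>c\<in>dihs m. \<Sum>d\<in>dihs m. - dsgn c * P d c * phi (Z d c) - - dsgn d * P d c * phi (Z d c))
      = (\<Sum>c\<in>dihs m. \<Sum>d\<in>dihs m. - dsgn d * P c d * phi (Z c d) - - dsgn c * P c d * phi (Z c d))"
    by (rule sum.swap)
  finally have "(\<Sum>c\<in>dihs m. \<Sum>d\<in>dihs m. - dsgn d * P c d * phi (Z c d) - - dsgn c * P c d * phi (Z c d)) = 0"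
    by simp
  then show ?thesis
    unfolding 1 2 by (simp only: sum_subtractf right_minus_eq)
qed

text \<open>Each of the six products is a double sum with its own group parameters. Translations and
  inverses in the group bring the three products belonging to one 3-cycle to a common image point,
  \<open>Z1 c d\<close> or \<open>Z2 c d\<close>; then coefficients can be compared for arbitrary
  \<open>phi\<close>.\<close>

lemma three_body:
  assumes q: "q \<in> U" and i: "i \<in> {1..N}" "k \<in> {1..N}" "j \<in> {1..N}" "i \<noteq> k" "i \<noteq> j" "k \<noteq> j"
  shows "pair_op m alpha i k (pair_op m alpha k j phi) q + pair_op m alpha i j (pair_op m beta i k phi) q
      + pair_op m alpha i j (pair_op m alpha k j phi) q
    = pair_op m alpha k j (pair_op m alpha i k phi) q + pair_op m beta i k (pair_op m alpha i j phi) q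
      + pair_op m alpha k j (pair_op m alpha i j phi) q"
proof -
  define x y z where "x = q i" and "y = q k" and "z = q j"
  note xyz = x_def[symmetric] y_def[symmetric] z_def[symmetric]
  have nx: "x \<noteq> 0" "y \<noteq> 0" "z \<noteq> 0" using nz[OF q] i by (auto simp: x_def y_def z_def)
  have fc: "fst c \<noteq> 0" if "c \<in> dihs m" for c using dihs_nz[OF m that] .
  \<comment> \<open>the images of \<open>q\<close> under products inducing the two 3-cycles of \<open>i\<close>, \<open>k\<close>, \<open>j\<close>\<close>
  define Z1 where "Z1 = (\<lambda>c d. q(i := act c y, k := act d z, j := act (dinv (dmul c d)) x))"
  define Z2 where "Z2 = (\<lambda>c d. q(i := act c z, k := act d x, j := act (dinv (dmul d c)) y))"
  \<comment> \<open>When \<open>i\<close>, \<open>j\<close> are reflected before \<open>i\<close>,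
    \<open>k\<close>, the two elements must be \<open>dmul c d\<close> and \<open>c\<close> for the
    image of \<open>q\<close> to be \<open>Z1 c d\<close>.\<close>
  have swap_left: "(\<Sum>c'\<in>dihs m. \<Sum>d'\<in>dihs m. G c' d') = (\<Sum>c\<in>dihs m. \<Sum>d\<in>dihs m. G (dmul c d) c)"
    for G :: "dih \<Rightarrow> dih \<Rightarrow> complex"
    by (subst sum.swap) (intro sum.cong refl sum_dihs_dmul(1)[OF m, symmetric])
  have A1: "pair_op m alpha i k (pair_op m alpha k j phi) q
      = (\<Sum>c\<in>dihs m. \<Sum>d\<in>dihs m. alpha c x y * alpha d (act (dinv c) x) z * phi (Z1 c d))"
  proof -
    have "reflect k j d (reflect i k c q) = Z1 c d" for c d
      using i by (auto simp: reflect_def Z1_def xyz fun_eq_iff)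
    then show ?thesis
      using i unfolding pair_op_def sum_distrib_left
      by (simp add: mult.assoc) (simp add: reflect_def xyz)
  qed
  have A2: "pair_op m alpha i j (pair_op m beta i k phi) q
      = (\<Sum>c\<in>dihs m. \<Sum>d\<in>dihs m. alpha (dmul c d) x z * beta c (act (dmul c d) z) y * phi (Z1 c d))"
  proof -
    have "reflect i k c (reflect i j (dmul c d) q) = Z1 c d" if "c \<in> dihs m" "d \<in> dihs m" for c d
      using i fc[OF that(1)] fc[OF that(2)] by (auto simp: reflect_def Z1_def xyz fun_eq_iff)
    then show ?thesis
      using i unfolding pair_op_def sum_distrib_left
      by (subst swap_left) (intro sum.cong refl, simp add: mult.assoc, simp add: reflect_def xyz)
  qed
  have A3: "pair_op m alpha k j (pair_op m alpha i j phi) q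
      = (\<Sum>c\<in>dihs m. \<Sum>d\<in>dihs m. alpha d y z * alpha (dmul c d) x (act (dinv d) y) * phi (Z1 c d))"
  proof -
    have "reflect i j (dmul c d) (reflect k j d q) = Z1 c d" if "c \<in> dihs m" "d \<in> dihs m" for c d
      using i fc[OF that(1)] fc[OF that(2)] by (auto simp: reflect_def Z1_def xyz fun_eq_iff)
    moreover have "pair_op m alpha k j (pair_op m alpha i j phi) q
        = (\<Sum>d\<in>dihs m. \<Sum>c\<in>dihs m. alpha d (q k) (q j)
          * (alpha (dmul c d) (reflect k j d q i) (reflect k j d q j) * phi (reflect i j (dmul c d) (reflect k j d q))))"
      unfolding pair_op_def sum_distrib_left
      by (intro sum.cong refl sum_dihs_dmul(2)[OF m, symmetric])
    ultimately show ?thesis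
      using i by (subst sum.swap) (simp add: mult.assoc, simp add: reflect_def xyz)
  qed
  have B1: "pair_op m alpha i j (pair_op m alpha k j phi) q
      = (\<Sum>c\<in>dihs m. \<Sum>d\<in>dihs m. alpha c x z * alpha (dmul d c) y (act (dinv c) x) * phi (Z2 c d))"
  proof -
    have "reflect k j (dmul d c) (reflect i j c q) = Z2 c d" if "c \<in> dihs m" "d \<in> dihs m" for c d
      using i fc[OF that(1)] fc[OF that(2)] by (auto simp: reflect_def Z2_def xyz fun_eq_iff)
    moreover have "pair_op m alpha i j (pair_op m alpha k j phi) q
        = (\<Sum>c\<in>dihs m. \<Sum>d\<in>dihs m. alpha c (q i) (q j)
          * (alpha (dmul d c) (reflect i j c q k) (reflect i j c q j) * phi (reflect k j (dmul d c) (reflect i j c q))))"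
      unfolding pair_op_def sum_distrib_left
      by (intro sum.cong refl sum_dihs_dmul(2)[OF m, symmetric])
    ultimately show ?thesis
      using i by (simp add: mult.assoc) (simp add: reflect_def xyz)
  qed
  have B2: "pair_op m alpha k j (pair_op m alpha i k phi) q
      = (\<Sum>c\<in>dihs m. \<Sum>d\<in>dihs m. alpha (dmul d c) y z * alpha (dinv d) x (act (dmul d c) z) * phi (Z2 c d))"
  proof -
    have "reflect i k (dinv d) (reflect k j (dmul d c) q) = Z2 c d" if "c \<in> dihs m" "d \<in> dihs m" for c d
      using i fc[OF that(1)] fc[OF that(2)] by (auto simp: reflect_def Z2_def xyz fun_eq_iff)
    moreover have "pair_op m alpha k j (pair_op m alpha i k phi) q
        = (\<Sum>d\<in>dihs m. \<Sum>c\<in>dihs m. alpha (dmul d c) (q k) (q j)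
          * (alpha (dinv d) (reflect k j (dmul d c) q i) (reflect k j (dmul d c) q k)
            * phi (reflect i k (dinv d) (reflect k j (dmul d c) q))))"
      unfolding pair_op_def sum_distrib_left
      by (subst sum.swap, subst sum_dihs_dinv[symmetric])
        (intro sum.cong refl sum_dihs_dmul(1)[OF m, symmetric])
    ultimately show ?thesis
      using i by (subst sum.swap) (simp add: mult.assoc, simp add: reflect_def xyz)
  qed
  have B3: "pair_op m beta i k (pair_op m alpha i j phi) q
      = (\<Sum>c\<in>dihs m. \<Sum>d\<in>dihs m. beta (dinv d) x y * alpha c (act (dinv d) y) z * phi (Z2 c d))"
  proof -
    have "reflect i j c (reflect i k (dinv d) q) = Z2 c d" if "c \<in> dihs m" "d \<in> dihs m" for c d
      using i fc[OF that(1)] fc[OF that(2)] by (auto simp: reflect_def Z2_def xyz fun_eq_iff)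
    moreover have "pair_op m beta i k (pair_op m alpha i j phi) q
        = (\<Sum>d\<in>dihs m. \<Sum>c\<in>dihs m. beta (dinv d) (q i) (q k)
          * (alpha c (reflect i k (dinv d) q i) (reflect i k (dinv d) q j)
            * phi (reflect i j c (reflect i k (dinv d) q))))"
      unfolding pair_op_def sum_distrib_left by (rule sum_dihs_dinv[symmetric])
    ultimately show ?thesis
      using i by (subst sum.swap) (simp add: mult.assoc, simp add: reflect_def xyz)
  qed
  have I1: "alpha c x y * alpha d (act (dinv c) x) z + alpha (dmul c d) x z * beta c (act (dmul c d) z) y
      = alpha d y z * alpha (dmul c d) x (act (dinv d) y)" if c: "c \<in> dihs m" and d: "d \<in> dihs m" for c d
  proof -
    \<comment> \<open>All points are transported to the place of \<open>x\<close>: the weights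
      become fractions in \<open>x\<close>, \<open>Y\<close>, \<open>Z\<close>, and of
      \<open>c\<close> and \<open>d\<close> only the types remain.\<close>
    define Y Z where "Y = act c y" and "Z = act c (act d z)"
    have cd: "dmul c d \<in> dihs m" using c d by auto
    note f = fc[OF c] fc[OF d]
    have "act d z \<noteq> y"
      using alpha_regular[OF q i(2,3,6) d] by (simp add: xyz)
    then have "Y \<noteq> Z"
      unfolding Y_def Z_def using act_dinv(1)[OF f(1)] by metis
    then have ne: "x \<noteq> Y" "x \<noteq> Z" "Y \<noteq> Z" "Y \<noteq> 0" "Z \<noteq> 0"
      using alpha_regular[OF q i(1,2,4) c] alpha_regular[OF q i(1,3,5) cd] f nx
      by (simp_all add: Y_def Z_def xyz)
    have y: "y = act (dinv c) Y" and z: "act d z = act (dinv c) Z"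
      using f by (simp_all add: Y_def Z_def)
    \<comment> \<open>Here the sign rule is applied at the reflected point, which is regular because
      \<open>U\<close> is invariant.\<close>
    have "beta c (act (dmul c d) z) y = - dsgn c * alpha c (act (dmul c d) z) y"
      using beta_eq_alpha[OF reflect_U[OF q i(1,3,5) cd] i(1,2,4) c] i by (simp add: reflect_def xyz)
    then have b: "beta c (act (dmul c d) z) y = - dsgn c * (Z / (Z - Y) - (if snd c then 1 else 0))"
      by (simp add: alpha_def alpha0_def Y_def Z_def)
    have a1: "alpha d (act (dinv c) x) z = (if snd c then x / (x - Z) else 1 - x / (x - Z)) - (if snd d then 1 else 0)"
      unfolding alpha_def alpha0_def z using alpha0_act[of "dinv c" x Z] ne nx f by simp
    have a2: "alpha d y z = (if snd c then Y / (Y - Z) else 1 - Y / (Y - Z)) - (if snd d then 1 else 0)"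
      unfolding alpha_def alpha0_def z unfolding y using alpha0_act[of "dinv c" Y Z] ne nx f by simp
    have a3: "alpha (dmul c d) x (act (dinv d) y) = x / (x - Y) - (if snd c = snd d then 1 else 0)"
      using f by (simp add: alpha_def alpha0_def Y_def)
    show ?thesis
      unfolding a1 a2 a3 b
      using three_body_identity_1[OF ne(1,2,3), of "snd c" "snd d"]
      by (simp add: alpha_def alpha0_def dsgn_def Y_def Z_def)
  qed
  have I2: "alpha c x z * alpha (dmul d c) y (act (dinv c) x)
      = alpha (dmul d c) y z * alpha (dinv d) x (act (dmul d c) z)
        + beta (dinv d) x y * alpha c (act (dinv d) y) z" if c: "c \<in> dihs m" and d: "d \<in> dihs m" for c d
  proof -
    define Y Z where "Y = act (dinv d) y" and "Z = act c z"
    have dc: "dmul d c \<in> dihs m" and d': "dinv d \<in> dihs m" using c d by auto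
    note f = fc[OF c] fc[OF d]
    have "act (dmul d c) z \<noteq> y"
      using alpha_regular[OF q i(2,3,6) dc] by (simp add: xyz)
    then have "Y \<noteq> Z"
      unfolding Y_def Z_def using act_dinv(2)[OF f(2)] by (metis act_dmul)
    then have ne: "x \<noteq> Y" "x \<noteq> Z" "Y \<noteq> Z" "Y \<noteq> 0" "Z \<noteq> 0"
      using alpha_regular[OF q i(1,2,4) d'] alpha_regular[OF q i(1,3,5) c] f nx
      by (simp_all add: Y_def Z_def xyz)
    have y: "y = act d Y" using f by (simp add: Y_def)
    have b: "beta (dinv d) x y = - dsgn d * (x / (x - Y) - (if snd d then 1 else 0))"
      using beta_eq_alpha[OF q i(1,2,4) d'] by (simp add: xyz alpha_def alpha0_def Y_def dsgn_def)
    have a1: "alpha (dmul d c) y (act (dinv c) x)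
        = (if snd d then Y / (Y - x) else 1 - Y / (Y - x)) - (if snd d = snd c then 1 else 0)"
      unfolding alpha_def alpha0_def y using alpha0_act[of d Y x] ne nx f by simp
    have a2: "alpha (dmul d c) y z
        = (if snd d then Y / (Y - Z) else 1 - Y / (Y - Z)) - (if snd d = snd c then 1 else 0)"
      unfolding alpha_def alpha0_def y using alpha0_act[of d Y Z] ne nx f by (simp add: Z_def)
    have a3: "alpha (dinv d) x (act (dmul d c) z) = x / (x - Z) - (if snd d then 1 else 0)"
      using f by (simp add: alpha_def alpha0_def Z_def)
    show ?thesis
      unfolding a1 a2 a3 b
      using three_body_identity_2[OF ne(1,2,3), of "snd c" "snd d"]
      by (simp add: alpha_def alpha0_def dsgn_def Y_def Z_def)
  qed
  have T1: "pair_op m alpha i k (pair_op m alpha k j phi) q + pair_op m alpha i j (pair_op m beta i k phi) q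
      = pair_op m alpha k j (pair_op m alpha i j phi) q"
    unfolding A1 A2 A3 sum.distrib[symmetric]
    by (intro sum.cong refl) (simp add: I1[symmetric] distrib_right)
  have T2: "pair_op m alpha i j (pair_op m alpha k j phi) q
      = pair_op m alpha k j (pair_op m alpha i k phi) q + pair_op m beta i k (pair_op m alpha i j phi) q"
    unfolding B1 B2 B3 sum.distrib[symmetric]
    by (intro sum.cong refl) (simp add: I2 distrib_right)
  show ?thesis unfolding T2 using T1 by simp
qed

end

context regular_domain
begin

text \<open>Conjugating \<open>rot g\<close> by \<open>c\<close> in the dihedral group gives \<open>rot (conj_root c g)\<close>.\<close>

definition conj_root :: "dih \<Rightarrow> complex \<Rightarrow> complex" where
  "conj_root c g = (if snd c then g * inverse (fst c) else inverse (g * fst c))"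

lemma rot_conj_root: "fst c \<noteq> 0 \<Longrightarrow> dmul (rot (conj_root c g)) c = dmul c (rot g)"
  by (simp add: dmul_def rot_def conj_root_def power2_eq_square)

text \<open>Conjugation by a fixed \<open>c\<close> permutes the roots themselves, with inverse
  given by \<open>dinv c\<close>. A bijection of the maps \<open>rot g\<close> alone would not
  suffice, as they need not determine \<open>g\<close>.\<close>

lemma sum_conj_root:
  assumes "c \<in> dihs m"
  shows "(\<Sum>g\<in>roots m. H (conj_root c g)) = (\<Sum>g\<in>roots m. H g)"
  using assms dihs_nz[OF m assms]
  by (intro sum.reindex_bij_witness[where i = "conj_root (dinv c)" and j = "conj_root c"])
    (auto simp: conj_root_def dinv_def dihs_def intro!: roots_mult roots_inverse)

lemma conj_root_dmul_rot: "g \<noteq> 0 \<Longrightarrow> fst c \<noteq> 0 \<Longrightarrow> conj_root (dmul c (rot g)) g = conj_root c g"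
  by (simp add: conj_root_def dmul_def rot_def power2_eq_square)

lemma kappa_1: "kappa mu rho g x = kappa mu rho 1 (g * x)"
  by (simp add: kappa_def mult.assoc)

text \<open>All four products are brought to the same image \<open>W c g\<close>. Moving the
  inversion from one coordinate of the pair to the other conjugates its root by \<open>c\<close>;
  performing it before instead of after the reflection on coordinate \<open>k\<close> multiplies
  \<open>c\<close> by \<open>rot g\<close>.\<close>

lemma one_body:
  assumes q: "q \<in> U" and i: "i \<in> {1..N}" "k \<in> {1..N}" "i \<noteq> k"
  shows "pair_op m alpha i k (one_op m (kappa mu rho) k phi) q + one_op m (kappa mu rho) i (pair_op m beta i k phi) q
    = one_op m (kappa mu rho) k (pair_op m alpha i k phi) q + pair_op m beta i k (one_op m (kappa mu rho) i phi) q"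
proof -
  define x y where "x = q i" and "y = q k"
  note xy = x_def[symmetric] y_def[symmetric]
  have nx: "x \<noteq> 0" "y \<noteq> 0" using nz[OF q] i by (auto simp: x_def y_def)
  have fc: "fst c \<noteq> 0" if "c \<in> dihs m" for c using dihs_nz[OF m that] .
  let ?k = "kappa mu rho"
  define W where "W = (\<lambda>c g. q(i := act c y, k := act (rot g) (act (dinv c) x)))"
  have A1: "pair_op m alpha i k (one_op m ?k k phi) q
      = (\<Sum>c\<in>dihs m. \<Sum>g\<in>roots m. alpha c x y * ?k g (act (dinv c) x) * phi (W c g))"
  proof -
    have "move k (rot g) (reflect i k c q) = W c g" for c g
      using i by (auto simp: reflect_def move_def W_def xy fun_eq_iff)
    then show ?thesis
      using i unfolding pair_op_def one_op_def sum_distrib_left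
      by (simp add: mult.assoc) (simp add: reflect_def xy)
  qed
  have A2: "one_op m ?k i (pair_op m beta i k phi) q
      = (\<Sum>c\<in>dihs m. \<Sum>g\<in>roots m. ?k (conj_root c g) x * beta c (act (rot (conj_root c g)) x) y * phi (W c g))"
  proof -
    have "reflect i k c (move i (rot (conj_root c g)) q) = W c g" if c: "c \<in> dihs m" and g: "g \<in> roots m" for c g
    proof -
      have "dinv (dmul (rot (conj_root c g)) c) = dinv (dmul c (rot g))"
        using rot_conj_root[OF fc[OF c]] by simp
      then have "act (dinv c) (act (rot (conj_root c g)) x) = act (rot g) (act (dinv c) x)"
        by (metis act_dmul dinv_dmul dinv_rot)
      then show ?thesis
        using i by (auto simp: reflect_def move_def W_def xy fun_eq_iff)
    qed
    moreover have "one_op m ?k i (pair_op m beta i k phi) q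
      = (\<Sum>c\<in>dihs m. \<Sum>g\<in>roots m. ?k (conj_root c g) (q i) *
         (beta c (move i (rot (conj_root c g)) q i) (move i (rot (conj_root c g)) q k) * phi (reflect i k c (move i (rot (conj_root c g)) q))))"
      unfolding pair_op_def one_op_def sum_distrib_left
      by (subst sum.swap) (intro sum.cong refl sum_conj_root[symmetric])
    ultimately show ?thesis
      using i by (simp add: mult.assoc) (simp add: move_def xy)
  qed
  have A3: "one_op m ?k k (pair_op m alpha i k phi) q
      = (\<Sum>c\<in>dihs m. \<Sum>g\<in>roots m. ?k g y * alpha (dmul c (rot g)) x (act (rot g) y) * phi (W c g))"
  proof -
    have "reflect i k (dmul c (rot g)) (move k (rot g) q) = W c g" if "c \<in> dihs m" and g: "g \<in> roots m" for c g
      using i fc[OF dihs_closed(3)[OF g]] act_dinv(2)[OF fc[OF dihs_closed(3)[OF g]]]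
      by (auto simp: reflect_def move_def W_def xy fun_eq_iff)
    moreover have "one_op m ?k k (pair_op m alpha i k phi) q
      = (\<Sum>g\<in>roots m. \<Sum>c\<in>dihs m. ?k g (q k) *
         (alpha (dmul c (rot g)) (move k (rot g) q i) (move k (rot g) q k) * phi (reflect i k (dmul c (rot g)) (move k (rot g) q))))"
      unfolding pair_op_def one_op_def sum_distrib_left
      by (intro sum.cong refl sum_dihs_dmul(2)[OF m, symmetric]) auto
    ultimately show ?thesis
      using i by (subst sum.swap) (simp add: mult.assoc, simp add: move_def xy)
  qed
  have A4: "pair_op m beta i k (one_op m ?k i phi) q
      = (\<Sum>c\<in>dihs m. \<Sum>g\<in>roots m. beta (dmul c (rot g)) x y * ?k (conj_root c g) (act (dmul c (rot g)) y) * phi (W c g))"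
  proof -
    have "move i (rot (conj_root c g)) (reflect i k (dmul c (rot g)) q) = W c g" if c: "c \<in> dihs m" and g: "g \<in> roots m" for c g
    proof -
      have "act (rot (conj_root c g)) (act (dmul c (rot g)) y) = act (dmul (dmul c (rot g)) (rot g)) y"
        by (metis rot_conj_root[OF fc[OF c]] act_dmul)
      also have "\<dots> = act c y"
        using act_dinv(2)[OF fc[OF dihs_closed(3)[OF g]]] by simp
      finally show ?thesis
        using i by (auto simp: reflect_def move_def W_def xy fun_eq_iff)
    qed
    moreover have "pair_op m beta i k (one_op m ?k i phi) q
      = (\<Sum>c\<in>dihs m. \<Sum>g\<in>roots m. beta (dmul c (rot g)) (q i) (q k) *
         (?k (conj_root c g) (reflect i k (dmul c (rot g)) q i) * phi (move i (rot (conj_root c g)) (reflect i k (dmul c (rot g)) q))))"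
      (is "_ = ?R")
    proof -
      \<comment> \<open>Two changes of variable are combined: the root is conjugated for fixed
        \<open>c\<close>, then \<open>c\<close> is shifted by \<open>rot g\<close> for fixed
        \<open>g\<close>. The shift leaves the conjugated root alone because \<open>rot g\<close>
        commutes with itself.\<close>
      define F where "F = (\<lambda>c g. beta c (q i) (q k) *
         (?k g (reflect i k c q i) * phi (move i (rot g) (reflect i k c q))))"
      have "pair_op m beta i k (one_op m ?k i phi) q = (\<Sum>c\<in>dihs m. \<Sum>g\<in>roots m. F c (conj_root c g))"
        unfolding pair_op_def one_op_def sum_distrib_left F_def
        by (intro sum.cong refl sum_conj_root[symmetric])
      also have "\<dots> = (\<Sum>g\<in>roots m. \<Sum>c\<in>dihs m. F c (conj_root (dmul c (rot g)) g))"
        using roots_nz[OF m] fc by (subst sum.swap) (simp add: conj_root_dmul_rot)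
      also have "\<dots> = (\<Sum>g\<in>roots m. \<Sum>c\<in>dihs m. F (dmul c (rot g)) (conj_root (dmul (dmul c (rot g)) (rot g)) g))"
        by (intro sum.cong refl sum_dihs_dmul(2)[OF m, symmetric]) auto
      also have "\<dots> = (\<Sum>c\<in>dihs m. \<Sum>g\<in>roots m. F (dmul c (rot g)) (conj_root c g))"
        using roots_nz[OF m] fc by (subst sum.swap) (simp add: conj_root_dmul_rot)
      finally show ?thesis unfolding F_def .
    qed
    ultimately show ?thesis
      using i by (simp add: mult.assoc) (simp add: reflect_def xy)
  qed
  have I: "alpha c x y * ?k g (act (dinv c) x) + ?k (conj_root c g) x * beta c (act (rot (conj_root c g)) x) y
      = ?k g y * alpha (dmul c (rot g)) x (act (rot g) y)
        + beta (dmul c (rot g)) x y * ?k (conj_root c g) (act (dmul c (rot g)) y)"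
    if c: "c \<in> dihs m" and g: "g \<in> roots m" for c g
  proof -
    \<comment> \<open>In the scaled coordinates \<open>rot h\<close> and \<open>rot g\<close> are
      plain inversions; the roots disappear and only the type of \<open>c\<close> is left.\<close>
    define h X Y where "h = conj_root c g" and "X = h * x" and "Y = g * y"
    have rg: "rot g \<in> dihs m" and rh: "rot h \<in> dihs m" and cr: "dmul c (rot g) \<in> dihs m" and h: "h \<in> roots m"
      using c g by (auto simp: h_def conj_root_def dihs_def rot_def dmul_def intro!: roots_mult roots_inverse roots_power)
    have f: "fst c \<noteq> 0" "g \<noteq> 0" "h \<noteq> 0" "X \<noteq> 0" "Y \<noteq> 0"
      using fc[OF c] roots_nz[OF m] g h nx by (auto simp: X_def Y_def)
    have s: "h * act c y = (if snd c then Y else inverse Y)"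
      "h * act (rot h) x = inverse X"
      "h * act (dmul c (rot g)) y = (if snd c then inverse Y else Y)"
      "g * act (dinv c) x = (if snd c then X else inverse X)"
      using f by (auto simp: act_def dinv_def dmul_def rot_def h_def conj_root_def X_def Y_def power2_eq_square)
        (simp_all add: field_simps)
    have "X \<noteq> h * act c y" "X \<noteq> h * act (dmul c (rot g)) y"
      using alpha_regular[OF q i c] alpha_regular[OF q i cr] f by (simp_all add: X_def xy)
    then have ne: "X \<noteq> Y" "X \<noteq> inverse Y"
      unfolding s by (cases "snd c"; simp)+
    have ne2: "X \<noteq> inverse X" "Y \<noteq> inverse Y"
      using kappa_regular[OF q i(1) h] kappa_regular[OF q i(2) g] by (simp_all add: X_def Y_def xy)
    have ne': "X * Y \<noteq> 1" "X * X \<noteq> 1" "Y * Y \<noteq> 1"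
      using ne ne2 f by (auto simp: field_simps)
    have scale: "alpha0 d a b = h * a / (h * a - h * act d b)" for d a b
      using f by (simp add: alpha0_def flip: right_diff_distrib)
    have p: "alpha c x y = (if snd c then X / (X - Y) - 1 else X / (X - inverse Y))"
      "alpha c (act (rot h) x) y = (if snd c then inverse X / (inverse X - Y) - 1 else inverse X / (inverse X - inverse Y))"
      "alpha (dmul c (rot g)) x (act (rot g) y) = (if snd c then X / (X - Y) else X / (X - inverse Y) - 1)"
      "alpha (dmul c (rot g)) x y = (if snd c then X / (X - inverse Y) else X / (X - Y) - 1)"
      unfolding alpha_def scale using s act_dinv(2)[OF fc[OF rg]] by (simp_all add: X_def[symmetric])
    \<comment> \<open>The factor \<open>rot g\<close> reverses the type of \<open>c\<close>, hence
      the opposite sign in the second equation.\<close>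
    have b: "beta c (act (rot h) x) y = - dsgn c * alpha c (act (rot h) x) y"
      "beta (dmul c (rot g)) x y = dsgn c * alpha (dmul c (rot g)) x y"
      using beta_eq_alpha[OF move_U[OF q i(1) rh] i c] beta_eq_alpha[OF q i cr] i
      by (simp_all add: move_def xy dsgn_def)
    have inv: "?k 1 (inverse z) = mu - ?k 1 z" if "z \<noteq> 0" "z \<noteq> inverse z" for z
      using kappa_inverse[of 1 z mu rho] that by simp
    have k: "?k g (act (dinv c) x) = (if snd c then ?k 1 X else mu - ?k 1 X)" "?k h x = ?k 1 X"
      "?k g y = ?k 1 Y" "?k h (act (dmul c (rot g)) y) = (if snd c then mu - ?k 1 Y else ?k 1 Y)"
      by (subst kappa_1, use s f ne2 in \<open>simp add: inv X_def[symmetric] Y_def[symmetric] del: act_dmul\<close>)+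
    show ?thesis
      unfolding h_def[symmetric] p b k
      using one_body_identity_1[OF f(4,5) ne(1) ne', of mu rho] one_body_identity_2[OF f(4,5) ne(1) ne', of mu rho]
      by (simp add: dsgn_def left_diff_distrib right_diff_distrib)
  qed
  show ?thesis
    unfolding A1 A2 A3 A4 sum.distrib[symmetric]
    by (intro sum.cong refl) (simp add: I distrib_right[symmetric])
qed

end

section \<open>First-order terms and the commutation theorem\<close>

text \<open>\<open>e\<close> is the value at \<open>q\<close> of the Euler derivative of \<open>phi\<close>, including differentiability, which
  \<^const>\<open>Euler\<close> does not assert.\<close>

definition has_euler :: "nat \<Rightarrow> cfun \<Rightarrow> complex \<Rightarrow> (nat \<Rightarrow> complex) \<Rightarrow> bool" where
  "has_euler i phi e q \<longleftrightarrow>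
     (\<exists>d. ((\<lambda>z. phi (q(i := z))) has_field_derivative d) (at (q i)) \<and> e = q i * d)"

lemma has_euler_imp_Euler: "has_euler i phi e q \<Longrightarrow> Euler i phi q = e"
  using Euler_eqI by (auto simp: has_euler_def)

lemma has_euler_Euler:
  "(\<lambda>z. phi (q(i := z))) field_differentiable at (q i) \<Longrightarrow> has_euler i phi (Euler i phi q) q"
  using Euler_eqI by (auto simp: has_euler_def field_differentiable_def)

lemma has_euler_add:
  assumes "has_euler i f e q" "has_euler i g e' q"
  shows "has_euler i (\<lambda>q. f q + g q) (e + e') q"
proof -
  obtain d d' where "((\<lambda>z. f (q(i := z))) has_field_derivative d) (at (q i))" "e = q i * d"
    "((\<lambda>z. g (q(i := z))) has_field_derivative d') (at (q i))" "e' = q i * d'"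
    using assms by (auto simp: has_euler_def)
  then show ?thesis
    unfolding has_euler_def by (intro exI[of _ "d + d'"]) (auto intro: DERIV_add simp: distrib_left)
qed

lemma has_euler_mult:
  assumes "has_euler i f e q" "has_euler i g e' q"
  shows "has_euler i (\<lambda>q. f q * g q) (e * g q + f q * e') q"
proof -
  obtain d d' where "((\<lambda>z. f (q(i := z))) has_field_derivative d) (at (q i))" "e = q i * d"
    "((\<lambda>z. g (q(i := z))) has_field_derivative d') (at (q i))" "e' = q i * d'"
    using assms by (auto simp: has_euler_def)
  then show ?thesis
    unfolding has_euler_def using DERIV_mult[of "\<lambda>z. f (q(i := z))" d "q i" UNIV "\<lambda>z. g (q(i := z))" d']
    by (intro exI[of _ "d * g q + d' * f q"]) (simp add: algebra_simps)
qed

lemma has_euler_const: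
  assumes "\<And>z. f (q(i := z)) = f q"
  shows "has_euler i f 0 q"
  unfolding has_euler_def assms by (intro exI[of _ 0]) simp

lemma has_euler_cmult: "has_euler i g e q \<Longrightarrow> has_euler i (\<lambda>q. k * g q) (k * e) q"
  using has_euler_mult[OF has_euler_const[of "\<lambda>_. k" q i]] by simp

lemma has_euler_sum:
  assumes "\<And>x. x \<in> A \<Longrightarrow> has_euler i (f x) (e x) q"
  shows "has_euler i (\<lambda>q. \<Sum>x\<in>A. f x q) (\<Sum>x\<in>A. e x) q"
  using assms
proof (induction A rule: infinite_finite_induct)
  case (insert x A)
  then show ?case by (simp add: has_euler_add)
qed (auto intro: has_euler_const)

lemma has_euler_chain:
  assumes "q i \<noteq> 0" "\<And>z. w (q(i := z)) = (w q)(j := act c z)" "w q j = act c (q i)"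
    "(\<lambda>z. phi ((w q)(j := z))) field_differentiable (at (w q j))"
  shows "has_euler i (\<lambda>q. phi (w q)) (dsgn c * Euler j phi (w q)) q"
  using has_euler_Euler[of "\<lambda>q. phi (w q)" q i, OF Euler_chain(2)[where w = w, OF assms]]
    Euler_chain(1)[where w = w, OF assms] by simp

text \<open>Up to \<open>dsgn c\<close>, the result is symmetric in \<open>q i\<close> and
  \<open>act c (q k)\<close>. This symmetry makes the derivative of \<open>beta\<close> in
  coordinate \<open>i\<close> agree with that of \<open>alpha\<close> in coordinate
  \<open>k\<close>.\<close>

lemma has_euler_alpha0_second:
  assumes "i \<noteq> k" "q i \<noteq> act c (q k)" "q k \<noteq> 0"
  shows "has_euler k (\<lambda>q. alpha0 c (q i) (q k)) (dsgn c * q i * act c (q k) / (q i - act c (q k))\<^sup>2) q"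
proof -
  have "((\<lambda>z. q i / (q i - act c z)) has_field_derivative
      q i * (dsgn c * act c (q k) / q k) / (q i - act c (q k))\<^sup>2) (at (q k))"
    using assms(2) by (auto intro!: derivative_eq_intros DERIV_act[OF assms(3)] simp: power2_eq_square)
  moreover have "dsgn c * q i * act c (q k) / (q i - act c (q k))\<^sup>2
      = q k * (q i * (dsgn c * act c (q k) / q k) / (q i - act c (q k))\<^sup>2)"
    using assms(3) by simp
  ultimately show ?thesis
    unfolding has_euler_def alpha0_def using assms(1) by (intro exI conjI) (auto simp: fun_upd_def)
qed

context regular_domain
begin

context
  fixes psi :: cfun
  assumes psi: "holo_on N U psi"
begin

lemma psi_differentiable: "q \<in> U \<Longrightarrow> i \<in> {1..N} \<Longrightarrow> (\<lambda>z. psi (q(i := z))) field_differentiable at (q i)"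
  using psi by (auto simp: holo_on_def)

text \<open>Freezing all other coordinates leaves a function of two variables on an open set. Each
  Euler factor is constant for the other derivative, so the common value is \<open>q i * q k\<close>
  times the mixed derivative.\<close>

lemma mixed_Euler:
  assumes q: "q \<in> U" and i: "i \<in> {1..N}" "k \<in> {1..N}" "i \<noteq> k"
  obtains e where "has_euler i (Euler k psi) e q" "has_euler k (Euler i psi) e q"
proof -
  define f where "f = (\<lambda>z w. psi (q(i := z, k := w)))"
  define s where "s = (\<lambda>(z, w). q(i := z, k := w))"
  define V where "V = s -` U"
  have s: "continuous_on UNIV s"
  proof (rule continuous_on_coordinatewise_then_product)
    show "continuous_on UNIV (\<lambda>x. s x l)" for l
      by (cases "l = k"; cases "l = i"; simp add: s_def case_prod_unfold continuous_on_fst continuous_on_snd)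
  qed
  have V: "open V"
    unfolding V_def using s openU by (simp add: continuous_on_open_vimage)
  have fs: "(\<lambda>(z, w). f z w) = psi \<circ> s" by (auto simp: f_def s_def fun_eq_iff)
  obtain d where d: "((\<lambda>z. deriv (f z) (q k)) has_field_derivative d) (at (q i))"
      "((\<lambda>w. deriv (\<lambda>z. f z w) (q i)) has_field_derivative d) (at (q k))"
  proof (rule mixed_partial_derivatives[OF V])
    show "(q i, q k) \<in> V" using q by (simp add: V_def s_def)
    show "continuous_on V (\<lambda>(z, w). f z w)"
      unfolding fs using psi by (intro continuous_on_compose continuous_on_subset[OF s])
        (auto simp: V_def holo_on_def elim: continuous_on_subset)
    show "(\<lambda>z. f z w) field_differentiable at z" if "(z, w) \<in> V" for z w
      using psi_differentiable[of "q(i := z, k := w)" i] that i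
      by (simp add: V_def s_def f_def fun_upd_twist)
    show "f z field_differentiable at w" if "(z, w) \<in> V" for z w
      using psi_differentiable[of "q(i := z, k := w)" k] that i
      by (simp add: V_def s_def f_def[abs_def])
  qed
  have "has_euler i (Euler k psi) (q i * (q k * d)) q"
    using DERIV_cmult[OF d(1), of "q k"] i unfolding has_euler_def Euler_def
    by (intro exI[of _ "q k * d"]) (simp add: f_def)
  moreover have "has_euler k (Euler i psi) (q i * (q k * d)) q"
    using DERIV_cmult[OF d(2), of "q i"] i unfolding has_euler_def Euler_def
    by (intro exI[of _ "q i * d"]) (simp add: f_def fun_upd_twist mult_ac)
  ultimately show ?thesis by (rule that)
qed

lemma has_euler_pair_other:
  assumes q: "q \<in> U" and i: "i \<in> {1..N}" "k \<in> {1..N}" "j \<in> {1..N}" "i \<noteq> k" "i \<noteq> j" "k \<noteq> j"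
  shows "has_euler i (pair_op m a k j psi) (pair_op m a k j (Euler i psi) q) q"
  unfolding pair_op_def[abs_def]
proof (rule has_euler_sum)
  fix c assume c: "c \<in> dihs m"
  \<comment> \<open>\<open>(1, True)\<close> is the identity substitution: coordinate
    \<open>i\<close> is left in place, so the sign is 1.\<close>
  have "has_euler i (\<lambda>q. psi (reflect k j c q)) (dsgn (1, True) * Euler i psi (reflect k j c q)) q"
    using i nz[OF q i(1)] psi_differentiable[OF reflect_U[OF q i(2,3,6) c] i(1)]
    by (intro has_euler_chain[where w = "reflect k j c"]) (auto simp: reflect_def act_def fun_upd_twist)
  from has_euler_mult[OF has_euler_const this, of "\<lambda>q. a c (q k) (q j)"]
  show "has_euler i (\<lambda>q. a c (q k) (q j) * psi (reflect k j c q)) (a c (q k) (q j) * Euler i psi (reflect k j c q)) q"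
    using i by (simp add: dsgn_def)
qed

lemma has_euler_one_other:
  assumes q: "q \<in> U" and i: "i \<in> {1..N}" "k \<in> {1..N}" "i \<noteq> k"
  shows "has_euler i (one_op m b k psi) (one_op m b k (Euler i psi) q) q"
  unfolding one_op_def[abs_def]
proof (rule has_euler_sum)
  fix g assume "g \<in> roots m"
  then have c: "rot g \<in> dihs m" by auto
  have "has_euler i (\<lambda>q. psi (move k (rot g) q)) (dsgn (1, True) * Euler i psi (move k (rot g) q)) q"
    using i nz[OF q i(1)] psi_differentiable[OF move_U[OF q i(2) c] i(1)]
    by (intro has_euler_chain[where w = "move k (rot g)"]) (auto simp: move_def act_def fun_upd_twist)
  from has_euler_mult[OF has_euler_const this, of "\<lambda>q. b g (q k)"]
  show "has_euler i (\<lambda>q. b g (q k) * psi (move k (rot g) q)) (b g (q k) * Euler i psi (move k (rot g) q)) q"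
    using i by (simp add: dsgn_def)
qed

text \<open>The commutator of \<open>Euler i\<close> with the \<open>beta\<close> sum and that of
  \<open>Euler k\<close> with the \<open>alpha\<close> sum have the same value \<open>e\<close> on
  \<open>psi\<close>; this is the cancellation of first-order terms.\<close>

lemma has_euler_pair:
  assumes q: "q \<in> U" and i: "i \<in> {1..N}" "k \<in> {1..N}" "i \<noteq> k"
  obtains e where "has_euler i (pair_op m beta i k psi) (e + pair_op m beta i k (Euler i psi) q) q"
    "has_euler k (pair_op m alpha i k psi) (e + pair_op m alpha i k (Euler k psi) q) q"
proof -
  define x y where "x = q i" and "y = q k"
  note xy = x_def[symmetric] y_def[symmetric]
  have nx: "x \<noteq> 0" "y \<noteq> 0" using nz[OF q] i by (auto simp: x_def y_def)
  \<comment> \<open>A reflection exchanges the two Euler derivatives up to \<open>dsgn c\<close>,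
    and by the sign rule this factor turns \<open>beta\<close> into \<open>- alpha\<close> and
    \<open>alpha\<close> into \<open>- beta\<close>. Subtracting the undifferentiated order as well
    makes the expression common to both commutators.\<close>
  define e where "e = (\<lambda>c. dsgn c * x * act c y / (x - act c y)\<^sup>2 * psi (reflect i k c q)
    - alpha c x y * Euler k psi (reflect i k c q) - beta c x y * Euler i psi (reflect i k c q))"
  have fc: "fst c \<noteq> 0" if "c \<in> dihs m" for c using dihs_nz[OF m that] .
  have B: "has_euler i (\<lambda>q. beta c (q i) (q k) * psi (reflect i k c q))
      (e c + beta c (q i) (q k) * Euler i psi (reflect i k c q)) q" if c: "c \<in> dihs m" for c
  proof -
    note reg = alpha_regular[OF q i c] alpha_regular[OF q i(2,1) i(3)[symmetric] dihs_closed(2)[OF c]]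
    have "has_euler i (\<lambda>q. psi (reflect i k c q)) (dsgn (dinv c) * Euler k psi (reflect i k c q)) q"
      using i nz[OF q i(1)] psi_differentiable[OF reflect_U[OF q i c] i(2)]
      by (intro has_euler_chain[where w = "reflect i k c"]) (auto simp: reflect_def)
    moreover have "has_euler i (\<lambda>q. beta c (q i) (q k)) (dsgn (dinv c) * y * act (dinv c) x / (y - act (dinv c) x)\<^sup>2) q"
      unfolding beta_def using has_euler_alpha0_second[of k i q "dinv c"] reg nz[OF q i(1)] i by (simp add: xy)
    moreover have "dsgn (dinv c) * y * act (dinv c) x / (y - act (dinv c) x)\<^sup>2 = dsgn c * x * act c y / (x - act c y)\<^sup>2"
    proof -
      have "y * act (dinv c) x / (y - act (dinv c) x)\<^sup>2 = x * act c y / (x - act c y)\<^sup>2"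
        using reg fc[OF c] nx unfolding xy
        by (cases "snd c"; simp add: act_def dinv_def divide_simps power2_eq_square; simp add: algebra_simps)
      then show ?thesis by (simp add: dsgn_def)
    qed
    moreover have "beta c x y * (dsgn (dinv c) * Euler k psi (reflect i k c q)) = - alpha c x y * Euler k psi (reflect i k c q)"
      using beta_eq_alpha[OF q i c] by (simp add: xy dsgn_def)
    ultimately show ?thesis
      using has_euler_mult[of i "\<lambda>q. beta c (q i) (q k)" _ q "\<lambda>q. psi (reflect i k c q)"]
      by (fastforce simp: e_def xy)
  qed
  have A: "has_euler k (\<lambda>q. alpha c (q i) (q k) * psi (reflect i k c q))
      (e c + alpha c (q i) (q k) * Euler k psi (reflect i k c q)) q" if c: "c \<in> dihs m" for c
  proof -
    note reg = alpha_regular[OF q i c]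
    have "has_euler k (\<lambda>q. psi (reflect i k c q)) (dsgn c * Euler i psi (reflect i k c q)) q"
      using i nz[OF q i(2)] psi_differentiable[OF reflect_U[OF q i c] i(1)]
      by (intro has_euler_chain[where w = "reflect i k c"]) (auto simp: reflect_def fun_upd_twist)
    moreover have "has_euler k (\<lambda>q. alpha c (q i) (q k)) (dsgn c * x * act c y / (x - act c y)\<^sup>2) q"
      using has_euler_add[OF has_euler_alpha0_second[of i k q c] has_euler_const[of "\<lambda>_. - (if snd c then 1 else 0)"]]
        reg nz[OF q i(2)] i by (simp add: xy alpha_def)
    moreover have "alpha c x y * (dsgn c * Euler i psi (reflect i k c q)) = - beta c x y * Euler i psi (reflect i k c q)"
      using beta_eq_alpha[OF q i c] by (simp add: xy)
    ultimately show ?thesis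
      using has_euler_mult[of k "\<lambda>q. alpha c (q i) (q k)" _ q "\<lambda>q. psi (reflect i k c q)"]
      by (fastforce simp: e_def xy)
  qed
  show ?thesis
  proof (rule that[of "\<Sum>c\<in>dihs m. e c"])
    show "has_euler i (pair_op m beta i k psi) ((\<Sum>c\<in>dihs m. e c) + pair_op m beta i k (Euler i psi) q) q"
      unfolding pair_op_def[abs_def] sum.distrib[symmetric] by (rule has_euler_sum) (rule B)
    show "has_euler k (pair_op m alpha i k psi) ((\<Sum>c\<in>dihs m. e c) + pair_op m alpha i k (Euler k psi) q) q"
      unfolding pair_op_def[abs_def] sum.distrib[symmetric] by (rule has_euler_sum) (rule A)
  qed
qed

end

lemma Dop_2_normal_form:
  assumes "N \<ge> 2"
  shows "Dop m N lam mu rho 2 phi q = Euler 2 phi q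
    + lam * (pair_op m beta 1 2 phi q + (\<Sum>j\<in>{3..N}. pair_op m alpha 2 j phi q)) + one_op m (kappa mu rho) 2 phi q"
proof -
  have 2: "{1..N} - {2} = insert 1 {3..N}" using assms by auto
  have "pair_op m beta 1 2 phi q = pair_op m alpha0 2 1 phi q"
    unfolding beta_def[abs_def] by (rule pair_op_flip) simp
  moreover have "(\<Sum>j\<in>{3..N}. pair_op m (if 2 < j then alpha else alpha0) 2 j phi q) = (\<Sum>j\<in>{3..N}. pair_op m alpha 2 j phi q)"
    by (rule sum.cong) auto
  ultimately show ?thesis unfolding Dop_normal_form[OF m] 2 by simp
qed

lemma Dop_commute:
  assumes N: "N \<ge> 2" and psi: "holo_on N U psi" and q: "q \<in> U"
  shows "Dop m N lam mu rho 1 (Dop m N lam mu rho 2 psi) q = Dop m N lam mu rho 2 (Dop m N lam mu rho 1 psi) q"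
proof -
  define J where "J = {3..N}"
  define T where "T = pair_op m alpha 1 2"
  define T' where "T' = pair_op m beta 1 2"
  define T1 where "T1 = pair_op m alpha 1"
  define T2 where "T2 = pair_op m alpha 2"
  define M1 where "M1 = one_op m (kappa mu rho) 1"
  define M2 where "M2 = one_op m (kappa mu rho) 2"
  define X1 where "X1 = (\<lambda>phi q. lam * (T phi q + (\<Sum>j\<in>J. T1 j phi q)) + M1 phi q)"
  define X2 where "X2 = (\<lambda>phi q. lam * (T' phi q + (\<Sum>j\<in>J. T2 j phi q)) + M2 phi q)"
  have 12: "1 \<in> {1..N}" "2 \<in> {1..N}" "(1::nat) \<noteq> 2" "(2::nat) \<noteq> 1" using N by auto
  have J: "j \<in> {1..N}" "1 \<noteq> j" "2 \<noteq> j" if "j \<in> J" for j using that by (auto simp: J_def)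
  have "{2..N} = insert 2 J" using N by (auto simp: J_def)
  then have D1: "Dop m N lam mu rho 1 phi = (\<lambda>q. Euler 1 phi q + X1 phi q)" for phi
    unfolding Dop_1_normal_form[OF m] X1_def T_def T1_def M1_def by (simp add: J_def fun_eq_iff)
  have D2: "Dop m N lam mu rho 2 phi = (\<lambda>q. Euler 2 phi q + X2 phi q)" for phi
    unfolding Dop_2_normal_form[OF N] X2_def T'_def T2_def M2_def by (simp add: J_def fun_eq_iff)

  have linT: "T (\<lambda>q. f q + g q) q = T f q + T g q" "T (\<lambda>q. k * f q) q = k * T f q"
      "T (\<lambda>q. \<Sum>x\<in>A. F x q) q = (\<Sum>x\<in>A. T (F x) q)" for f g k q and A :: "nat set" and F
    unfolding T_def by (rule pair_op_linear)+
  have linT': "T' (\<lambda>q. f q + g q) q = T' f q + T' g q" "T' (\<lambda>q. k * f q) q = k * T' f q"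
      "T' (\<lambda>q. \<Sum>x\<in>A. F x q) q = (\<Sum>x\<in>A. T' (F x) q)" for f g k q and A :: "nat set" and F
    unfolding T'_def by (rule pair_op_linear)+
  have linT1: "T1 j (\<lambda>q. f q + g q) q = T1 j f q + T1 j g q" "T1 j (\<lambda>q. k * f q) q = k * T1 j f q"
      "T1 j (\<lambda>q. \<Sum>x\<in>A. F x q) q = (\<Sum>x\<in>A. T1 j (F x) q)" for f g k q j and A :: "nat set" and F
    unfolding T1_def by (rule pair_op_linear)+
  have linT2: "T2 j (\<lambda>q. f q + g q) q = T2 j f q + T2 j g q" "T2 j (\<lambda>q. k * f q) q = k * T2 j f q"
      "T2 j (\<lambda>q. \<Sum>x\<in>A. F x q) q = (\<Sum>x\<in>A. T2 j (F x) q)" for f g k q j and A :: "nat set" and F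
    unfolding T2_def by (rule pair_op_linear)+
  have linM1: "M1 (\<lambda>q. f q + g q) q = M1 f q + M1 g q" "M1 (\<lambda>q. k * f q) q = k * M1 f q"
      "M1 (\<lambda>q. \<Sum>x\<in>A. F x q) q = (\<Sum>x\<in>A. M1 (F x) q)" for f g k q and A :: "nat set" and F
    unfolding M1_def by (rule one_op_linear)+
  have linM2: "M2 (\<lambda>q. f q + g q) q = M2 f q + M2 g q" "M2 (\<lambda>q. k * f q) q = k * M2 f q"
      "M2 (\<lambda>q. \<Sum>x\<in>A. F x q) q = (\<Sum>x\<in>A. M2 (F x) q)" for f g k q and A :: "nat set" and F
    unfolding M2_def by (rule one_op_linear)+
  note lins = linT linT' linT1 linT2 linM1 linM2
  have X_add: "X1 (\<lambda>q. f q + g q) q = X1 f q + X1 g q" "X2 (\<lambda>q. f q + g q) q = X2 f q + X2 g q" for f g q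
    by (simp_all add: X1_def X2_def lins sum.distrib algebra_simps)

  have XX: "X1 (X2 psi) q = X2 (X1 psi) q"
  proof -
    define P where "P = (\<lambda>j. T (T2 j psi) q + T1 j (T' psi) q)"
    define P' where "P' = (\<lambda>j. T2 j (T psi) q + T' (T1 j psi) q)"
    have tb: "T (T' psi) q = T' (T psi) q"
      unfolding T_def T'_def by (rule two_body[OF q 12(1-3)])
    have "P j + T1 j (T2 j psi) q = P' j + T2 j (T1 j psi) q" if "j \<in> J" for j
      unfolding P_def P'_def T_def T'_def T1_def T2_def by (rule three_body[OF q 12(1,2) J(1)[OF that] 12(3) J(2,3)[OF that]])
    \<comment> \<open>Products over disjoint pairs commute, so only the diagonal
      \<open>j = k\<close> has a defect; the three-body relation expresses it through products with
      the pair 1, 2.\<close>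
    then have "T1 j (T2 k psi) q = T2 k (T1 j psi) q + (if j = k then P' k - P k else 0)" if "j \<in> J" "k \<in> J" for j k
      using pair_pair_disjoint[of 1 j 2 k m alpha alpha psi q] that J[OF that(1)] J[OF that(2)]
      by (auto simp: T1_def T2_def algebra_simps)
    then have "(\<Sum>j\<in>J. \<Sum>k\<in>J. T1 j (T2 k psi) q) = (\<Sum>j\<in>J. \<Sum>k\<in>J. T2 k (T1 j psi) q + (if j = k then P' k - P k else 0))"
      by (intro sum.cong refl) auto
    also have "\<dots> = (\<Sum>j\<in>J. \<Sum>k\<in>J. T2 k (T1 j psi) q) + (\<Sum>j\<in>J. P' j) - (\<Sum>j\<in>J. P j)"
      by (simp add: sum.distrib sum.delta' J_def sum_subtractf)
    also have "(\<Sum>j\<in>J. \<Sum>k\<in>J. T2 k (T1 j psi) q) = (\<Sum>k\<in>J. \<Sum>j\<in>J. T2 k (T1 j psi) q)"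
      by (rule sum.swap)
    finally have thb: "(\<Sum>j\<in>J. T (T2 j psi) q) + (\<Sum>j\<in>J. T1 j (T' psi) q) + (\<Sum>j\<in>J. \<Sum>k\<in>J. T1 j (T2 k psi) q)
        = (\<Sum>j\<in>J. T2 j (T psi) q) + (\<Sum>j\<in>J. T' (T1 j psi) q) + (\<Sum>k\<in>J. \<Sum>j\<in>J. T2 k (T1 j psi) q)"
      by (simp add: P_def P'_def sum.distrib algebra_simps)
    have ob: "T (M2 psi) q + M1 (T' psi) q = M2 (T psi) q + T' (M1 psi) q"
      unfolding T_def T'_def M1_def M2_def by (rule one_body[OF q 12(1-3)])
    have d: "T1 j (M2 psi) q = M2 (T1 j psi) q" "M1 (T2 j psi) q = T2 j (M1 psi) q" if "j \<in> J" for j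
      using J[OF that] pair_one_disjoint[of 2 1 j m alpha "kappa mu rho" psi q]
        pair_one_disjoint[of 1 2 j m alpha "kappa mu rho" psi q]
      by (auto simp: T1_def T2_def M1_def M2_def)
    have oo: "M1 (M2 psi) q = M2 (M1 psi) q"
      unfolding M1_def M2_def by (rule one_one_disjoint) simp
    \<comment> \<open>Expansion in powers of \<open>lam\<close>, bracketed so that the relations
      just collected apply to whole groups of terms.\<close>
    have "X1 (X2 psi) q = lam * lam * (T (T' psi) q + ((\<Sum>j\<in>J. T (T2 j psi) q) + (\<Sum>j\<in>J. T1 j (T' psi) q)
          + (\<Sum>j\<in>J. \<Sum>k\<in>J. T1 j (T2 k psi) q)))
        + lam * ((T (M2 psi) q + M1 (T' psi) q) + (\<Sum>j\<in>J. T1 j (M2 psi) q) + (\<Sum>j\<in>J. M1 (T2 j psi) q))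
        + M1 (M2 psi) q"
      unfolding X1_def X2_def lins by (simp add: sum.distrib sum_distrib_left[symmetric] algebra_simps)
    moreover have "X2 (X1 psi) q = lam * lam * (T' (T psi) q + ((\<Sum>j\<in>J. T2 j (T psi) q) + (\<Sum>j\<in>J. T' (T1 j psi) q)
          + (\<Sum>k\<in>J. \<Sum>j\<in>J. T2 k (T1 j psi) q)))
        + lam * ((M2 (T psi) q + T' (M1 psi) q) + (\<Sum>j\<in>J. M2 (T1 j psi) q) + (\<Sum>j\<in>J. T2 j (M1 psi) q))
        + M2 (M1 psi) q"
      unfolding X1_def X2_def lins by (simp add: sum.distrib sum_distrib_left[symmetric] algebra_simps)
    ultimately show ?thesis
      unfolding tb thb ob oo using d by simp
  qed

  obtain e where e: "has_euler 1 (Euler 2 psi) e q" "has_euler 2 (Euler 1 psi) e q"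
    by (rule mixed_Euler[OF psi q 12(1-3)])
  obtain c where c: "has_euler 1 (T' psi) (c + T' (Euler 1 psi) q) q" "has_euler 2 (T psi) (c + T (Euler 2 psi) q) q"
    unfolding T_def T'_def by (rule has_euler_pair[OF psi q 12(1-3)])
  have "has_euler 1 (T2 j psi) (T2 j (Euler 1 psi) q) q" "has_euler 2 (T1 j psi) (T1 j (Euler 2 psi) q) q"
    if "j \<in> J" for j
    unfolding T1_def T2_def
    by (rule has_euler_pair_other[OF psi q 12(1,2) J(1)[OF that] 12(3) J(2,3)[OF that]]
        has_euler_pair_other[OF psi q 12(2,1) J(1)[OF that] 12(4) J(3,2)[OF that]])+
  then have s: "has_euler 1 (\<lambda>q. \<Sum>j\<in>J. T2 j psi q) (\<Sum>j\<in>J. T2 j (Euler 1 psi) q) q"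
    "has_euler 2 (\<lambda>q. \<Sum>j\<in>J. T1 j psi q) (\<Sum>j\<in>J. T1 j (Euler 2 psi) q) q"
    by (intro has_euler_sum; blast)+
  have o: "has_euler 1 (M2 psi) (M2 (Euler 1 psi) q) q" "has_euler 2 (M1 psi) (M1 (Euler 2 psi) q) q"
    unfolding M1_def M2_def
    by (rule has_euler_one_other[OF psi q 12(1-3)] has_euler_one_other[OF psi q 12(2,1,4)])+
  \<comment> \<open>The terms \<open>e\<close> and \<open>lam * c\<close> occur identically in
    \<open>E1\<close> and \<open>E2\<close>; the remaining first-order terms reappear when
    \<open>X1\<close> and \<open>X2\<close> are applied to the Euler parts.\<close>
  have E1: "Euler 1 (\<lambda>q. Euler 2 psi q + X2 psi q) q = e + (lam * c + X2 (Euler 1 psi) q)"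
    using has_euler_imp_Euler[OF has_euler_add[OF e(1) has_euler_add[OF has_euler_cmult[OF has_euler_add[OF c(1) s(1)], of lam] o(1)]]]
    by (simp add: X2_def algebra_simps)
  have E2: "Euler 2 (\<lambda>q. Euler 1 psi q + X1 psi q) q = e + (lam * c + X1 (Euler 2 psi) q)"
    using has_euler_imp_Euler[OF has_euler_add[OF e(2) has_euler_add[OF has_euler_cmult[OF has_euler_add[OF c(2) s(2)], of lam] o(2)]]]
    by (simp add: X1_def algebra_simps)
  show ?thesis
    unfolding D1 D2 E1 E2 X_add XX by simp
qed

end

theorem theorem2:
  fixes m N :: nat and lam mu rho :: complex
    and U :: "(nat \<Rightarrow> complex) set" and psi :: cfun
  defines "D \<equiv> Dop m N lam mu rho"
  assumes "m \<ge> 1" and "N \<ge> 1"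
    and "open U" and "U \<subseteq> Reg m N" and "invariant_dom m N U"
    and "holo_on N U psi"
  shows
   "((\<forall>q\<in>U. Kop 1 (D 1 psi) q = - D 1 (Kop 1 psi) q + mu * (\<Sum>s<m. Qpow m 1 (2 * int s) psi q))
    \<and> (\<forall>q\<in>U. Qpow m 1 1 (D 1 psi) q = D 1 (Qpow m 1 1 psi) q))
  \<and> (N \<ge> 2 \<longrightarrow>
     (let A = (\<lambda>phi q. D 1 phi q + lam * (\<Sum>s<m. Qpow m 1 (- int s) (Pop 1 2 (Qpow m 1 (int s) phi)) q))
      in \<forall>q\<in>U. A (Kop 2 psi) q = Kop 2 (A psi) q)
    \<and> (\<forall>q\<in>U. D 1 (Qpow m 2 1 psi) q = Qpow m 2 1 (D 1 psi) q))
  \<and> (N \<ge> 2 \<longrightarrow>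
     (let B = (\<lambda>phi q. Pop 1 2 (D 1 (Pop 1 2 phi)) q
                 + lam * (\<Sum>s<m. Qpow m 1 (int s) (Pop 1 2 (Qpow m 1 (- int s) phi)) q))
      in \<forall>q\<in>U. D 1 (B psi) q = B (D 1 psi) q))
  \<and> (\<forall>j. 1 < j \<and> j \<le> N - 1 \<longrightarrow> (\<forall>q\<in>U. Pop j (j+1) (D 1 psi) q = D 1 (Pop j (j+1) psi) q))
  \<and> (\<forall>i\<in>{1..N-1}. \<forall>q\<in>U.
       D (i+1) psi q = Pop i (i+1) (D i (Pop i (i+1) psi)) q
         + lam * (\<Sum>s<m. Qpow m i (int s) (Pop i (i+1) (Qpow m i (- int s) psi)) q))"
proof -
  interpret regular_domain m N U
    using assms by unfold_locales auto
  have K1: "\<forall>q\<in>U. Kop 1 (D 1 psi) q = - D 1 (Kop 1 psi) q + mu * (\<Sum>s<m. Qpow m 1 (2 * int s) psi q)"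
    unfolding D_def using Dop_K1[OF _ assms(3,7)] by blast
  have Q1: "\<forall>q\<in>U. Qpow m 1 1 (D 1 psi) q = D 1 (Qpow m 1 1 psi) q"
    unfolding D_def using Dop_Q1[OF _ assms(3,7)] by blast
  \<comment> \<open>An equality of operators rather than of values: it is used both inside
    \<open>D 1\<close> and with \<open>D 1 psi\<close> as argument.\<close>
  have B: "(\<lambda>phi q. Pop 1 2 (D 1 (Pop 1 2 phi)) q
      + lam * (\<Sum>s<m. Qpow m 1 (int s) (Pop 1 2 (Qpow m 1 (- int s) phi)) q)) = D 2" if "N \<ge> 2"
    unfolding D_def using Dop_Suc[OF assms(2), of 1 N lam mu rho] that
    by (simp add: fun_eq_iff numeral_2_eq_2)
  have C: "\<forall>q\<in>U. D 1 (D 2 psi) q = D 2 (D 1 psi) q" if "N \<ge> 2"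
    unfolding D_def using Dop_commute[OF that assms(7)] by blast
  show ?thesis
    unfolding Let_def
  proof (intro conjI impI K1 Q1)
    assume N: "N \<ge> 2"
    show "\<forall>q\<in>U. D 1 (Kop 2 psi) q + lam * (\<Sum>s<m. Qpow m 1 (- int s) (Pop 1 2 (Qpow m 1 (int s) (Kop 2 psi))) q)
      = Kop 2 (\<lambda>q. D 1 psi q + lam * (\<Sum>s<m. Qpow m 1 (- int s) (Pop 1 2 (Qpow m 1 (int s) psi)) q)) q"
      unfolding D_def using reduced_Dop_K2[OF assms(2) N] by blast
    show "\<forall>q\<in>U. D 1 (Qpow m 2 1 psi) q = Qpow m 2 1 (D 1 psi) q"
      unfolding D_def using Dop_Q2[OF assms(2) N] by blast
    show "\<forall>q\<in>U. D 1 (\<lambda>q. Pop 1 2 (D 1 (Pop 1 2 psi)) q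
        + lam * (\<Sum>s<m. Qpow m 1 (int s) (Pop 1 2 (Qpow m 1 (- int s) psi)) q)) q
      = Pop 1 2 (D 1 (Pop 1 2 (D 1 psi))) q
        + lam * (\<Sum>s<m. Qpow m 1 (int s) (Pop 1 2 (Qpow m 1 (- int s) (D 1 psi))) q)"
      using C[OF N] unfolding B[OF N, symmetric] .
  next
    show "\<forall>j. 1 < j \<and> j \<le> N - 1 \<longrightarrow> (\<forall>q\<in>U. Pop j (j+1) (D 1 psi) q = D 1 (Pop j (j+1) psi) q)"
      unfolding D_def using Dop_Pop_commute[OF assms(2)] by blast
    show "\<forall>i\<in>{1..N-1}. \<forall>q\<in>U. D (i+1) psi q = Pop i (i+1) (D i (Pop i (i+1) psi)) q
        + lam * (\<Sum>s<m. Qpow m i (int s) (Pop i (i+1) (Qpow m i (- int s) psi)) q)"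
      unfolding D_def using Dop_Suc[OF assms(2)] by blast
  qed
qed

end
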